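(* Let $S\in GL_2(\mathbb{Z})$. For $n\ge2$ let $G_n^S=(V_n,E_n^S)$ be the undirected graph with $V_n=(\mathbb{Z}/n\mathbb{Z})^2$ in which $E_n^S$ contains, for every $(x,y)\in V_n$, an edge from $(x,y)$ to each of $(x+1,y)$, $(x,y+1)$, $S(x,y)$ and $S^{\top}(x,y)$. Then $\{G_n^S\}_{n\ge2}$ forms an expander family if and only if the infinite graph $$G^S=\left(\mathbb{Z}^2\setminus\{0\},\ \left\{\{z,Sz\},\{z,S^{\top}z\}: z\in\mathbb{Z}^2\setminus\{0\}\right\}\right)$$ has positive Cheeger constant.
   Context: $S^{\top}$ denotes the transpose of $S$; arithmetic in $V_n$ is modulo $n$. An infinite graph $G=(V,E)$ with uniformly bounded degrees has positive Cheeger constant if there is $\varepsilon>0$ such that every finite $U\subseteq V$ has at least $\varepsilon|U|$ edges with exactly one endpoint in $U$. For a finite graph $G=(V,E)$, $\lambda_2(G)$ is the minimum of $\frac{\sum_{\{u,v\}\in E}|f(u)-f(v)|^2}{\sum_{u\in V}|f(u)|^2}$ over nonzero $f:V\to\mathbb{C}$ with $\sum_{u\in V}f(u)=0$. An infinite family $\{G_n\}$ of finite graphs with uniformly bounded degrees is an expander family if there is a constant $c>0$ with $\lambda_2(G_n)\ge c$ for all $n$. *)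

theory Defs
  imports "HOL-Analysis.Analysis"
begin

text \<open>
  An undirected graph is a pair of a vertex set and a set of unordered pairs of vertices.
  A loop at \<open>v\<close> is the edge \<open>{v, v} = {v}\<close>; there are no parallel edges.
\<close>

type_synonym 'a ugraph = "'a set \<times> 'a set set"

abbreviation verts :: "'a ugraph \<Rightarrow> 'a set" where "verts \<equiv> fst"
abbreviation edges :: "'a ugraph \<Rightarrow> 'a set set" where "edges \<equiv> snd"

definition is_ugraph :: "'a ugraph \<Rightarrow> bool" where
  "is_ugraph G \<longleftrightarrow> (\<forall>e\<in>edges G. \<exists>u\<in>verts G. \<exists>v\<in>verts G. e = {u, v})"

definition degrees_bounded_by :: "nat \<Rightarrow> 'a ugraph \<Rightarrow> bool" where
  "degrees_bounded_by d G \<longleftrightarrow>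
     (\<forall>v\<in>verts G. finite {e \<in> edges G. v \<in> e} \<and> card {e \<in> edges G. v \<in> e} \<le> d)"

text \<open>Loops have no boundary: \<open>card (e \<inter> U) = 1\<close> would wrongly count them.\<close>

definition edge_boundary :: "'a ugraph \<Rightarrow> 'a set \<Rightarrow> 'a set set" where
  "edge_boundary G U = {e \<in> edges G. \<exists>u v. e = {u, v} \<and> u \<in> U \<and> v \<notin> U}"

definition positive_Cheeger_constant :: "'a ugraph \<Rightarrow> bool" where
  "positive_Cheeger_constant G \<longleftrightarrow>
     is_ugraph G \<and> infinite (verts G) \<and> (\<exists>d. degrees_bounded_by d G) \<and>
     (\<exists>\<epsilon>::real. \<epsilon> > 0 \<and>
        (\<forall>U. finite U \<and> U \<subseteq> verts G \<longrightarrow> real (card (edge_boundary G U)) \<ge> \<epsilon> * real (card U)))"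

text \<open>The value \<open>|f u - f v|\<^sup>2\<close> attached to an edge \<open>e = {u, v}\<close>; it is independent of the
  order of the endpoints.\<close>

definition edge_energy :: "('a \<Rightarrow> complex) \<Rightarrow> 'a set \<Rightarrow> real" where
  "edge_energy f e = (THE r. \<exists>u v. e = {u, v} \<and> r = (cmod (f u - f v))\<^sup>2)"

lemma edge_energy_pair [simp]: "edge_energy f {u, v} = (cmod (f u - f v))\<^sup>2"
  unfolding edge_energy_def
  by (rule the_equality) (auto simp: doubleton_eq_iff norm_minus_commute)

definition rayleigh_quotient :: "'a ugraph \<Rightarrow> ('a \<Rightarrow> complex) \<Rightarrow> real" where
  "rayleigh_quotient G f =
     (\<Sum>e\<in>edges G. edge_energy f e) / (\<Sum>u\<in>verts G. (cmod (f u))\<^sup>2)"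

text \<open>Functions on the vertex set are total functions whose values off the vertex set are
  irrelevant. The infimum below is a minimum, see \<open>lambda2_attained\<close>.\<close>

definition test_functions :: "'a ugraph \<Rightarrow> ('a \<Rightarrow> complex) set" where
  "test_functions G = {f. (\<exists>u\<in>verts G. f u \<noteq> 0) \<and> (\<Sum>u\<in>verts G. f u) = 0}"

definition lambda2 :: "'a ugraph \<Rightarrow> real" where
  "lambda2 G = (INF f\<in>test_functions G. rayleigh_quotient G f)"

lemma lambda2_attained:
  assumes G: "is_ugraph G" and fin: "finite (verts G)" and ne: "test_functions G \<noteq> {}"
  shows "\<exists>f\<in>test_functions G. rayleigh_quotient G f = lambda2 G \<and>
           (\<forall>g\<in>test_functions G. rayleigh_quotient G f \<le> rayleigh_quotient G g)"
proof -
  define V where "V = verts G"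
  define K where "K = {f. (\<Sum>u\<in>V. f u) = (0::complex)} \<inter> {f. (\<Sum>u\<in>V. (cmod (f u))\<^sup>2) = 1}
                        \<inter> PiE UNIV (\<lambda>v. if v \<in> V then cball 0 1 else {0})"
  have finV: "finite V" using fin by (simp add: V_def)
  have cont: "continuous_on A (\<lambda>f::'a \<Rightarrow> complex. f u)" for A u
    by (rule continuous_on_subset[of UNIV]) (auto intro: continuous_on_product_coordinates)
  have "compact (PiE UNIV (\<lambda>v. if v \<in> V then cball 0 1 else {0::complex}))"
    using compactin_PiE[of "\<lambda>_. euclidean" UNIV "\<lambda>v. if v \<in> V then cball 0 1 else {0::complex}"]
    by (auto simp: euclidean_product_topology)
  moreover have "closed {f. (\<Sum>u\<in>V. f u) = (0::complex)}"
    by (intro closed_Collect_eq continuous_intros cont)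
  moreover have "closed {f. (\<Sum>u\<in>V. (cmod (f u))\<^sup>2) = 1}"
    by (intro closed_Collect_eq continuous_intros cont)
  ultimately have compK: "compact K"
    unfolding K_def by (intro closed_Int_compact closed_Int)
  define N where "N = (\<lambda>f. \<Sum>u\<in>V. (cmod (f u))\<^sup>2)"
  define T where "T = (\<lambda>f u. if u \<in> V then f u / of_real (sqrt (N f)) else (0::complex))"
  have Npos: "N f > 0" if "f \<in> test_functions G" for f
  proof -
    from that obtain u where "u \<in> V" "f u \<noteq> 0" by (auto simp: test_functions_def V_def)
    then show ?thesis unfolding N_def
      by (intro sum_pos2[OF finV, of u]) auto
  qed
  have TK: "T f \<in> K" if f: "f \<in> test_functions G" for f
  proof -
    have n: "(\<Sum>u\<in>V. (cmod (T f u))\<^sup>2) = 1"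
    proof -
      have "(\<Sum>u\<in>V. (cmod (T f u))\<^sup>2) = (\<Sum>u\<in>V. (cmod (f u))\<^sup>2 / N f)"
        using Npos[OF f] by (intro sum.cong) (auto simp: T_def norm_divide power_divide)
      also have "\<dots> = N f / N f"
        unfolding sum_divide_distrib[symmetric] by (simp add: N_def)
      finally show ?thesis using Npos[OF f] by simp
    qed
    have s: "(\<Sum>u\<in>V. T f u) = 0"
    proof -
      have "(\<Sum>u\<in>V. T f u) = (\<Sum>u\<in>V. f u) / of_real (sqrt (N f))"
        by (simp add: T_def sum_divide_distrib)
      then show ?thesis using f by (simp add: test_functions_def V_def)
    qed
    have "cmod (T f u) \<le> 1" if "u \<in> V" for u
    proof -
      have "(cmod (T f u))\<^sup>2 \<le> (\<Sum>u\<in>V. (cmod (T f u))\<^sup>2)"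
        using that finV by (intro member_le_sum) auto
      then show ?thesis using n by (simp add: power2_le_imp_le abs_square_le_1)
    qed
    then show ?thesis using n s by (auto simp: K_def T_def)
  qed
  have KT: "f \<in> test_functions G" if "f \<in> K" for f
  proof -
    have "\<exists>u\<in>V. f u \<noteq> 0"
    proof (rule ccontr)
      assume "\<not> ?thesis"
      then have "(\<Sum>u\<in>V. (cmod (f u))\<^sup>2) = 0" by simp
      then show False using that by (simp add: K_def)
    qed
    then show ?thesis using that by (auto simp: K_def test_functions_def V_def)
  qed
  have RT: "rayleigh_quotient G (T f) = rayleigh_quotient G f" if f: "f \<in> test_functions G" for f
  proof -
    have "edge_energy (T f) e = edge_energy f e / N f" if e: "e \<in> edges G" for e
    proof -
      from e G obtain u v where uv: "u \<in> V" "v \<in> V" "e = {u, v}"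
        by (auto simp: is_ugraph_def V_def)
      then have "T f u - T f v = (f u - f v) / of_real (sqrt (N f))"
        by (simp add: T_def diff_divide_distrib)
      then show ?thesis using Npos[OF f] uv by (simp add: norm_divide power_divide)
    qed
    then have "(\<Sum>e\<in>edges G. edge_energy (T f) e) = (\<Sum>e\<in>edges G. edge_energy f e) / N f"
      by (simp add: sum_divide_distrib)
    then show ?thesis
      using TK[OF f] by (simp add: rayleigh_quotient_def K_def N_def V_def)
  qed
  have "K \<noteq> {}" using ne TK by auto
  moreover have "continuous_on K (\<lambda>f. \<Sum>e\<in>edges G. edge_energy f e)"
  proof (intro continuous_on_sum)
    fix e assume "e \<in> edges G"
    then obtain u v where "e = {u, v}" using G by (auto simp: is_ugraph_def)
    then show "continuous_on K (\<lambda>f. edge_energy f e)"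
      by (simp add: continuous_intros cont)
  qed
  ultimately obtain f where f: "f \<in> K"
    and fmin: "\<And>g. g \<in> K \<Longrightarrow> (\<Sum>e\<in>edges G. edge_energy f e) \<le> (\<Sum>e\<in>edges G. edge_energy g e)"
    using continuous_attains_inf[OF compK] by blast
  have RK: "rayleigh_quotient G g = (\<Sum>e\<in>edges G. edge_energy g e)" if "g \<in> K" for g
    using that by (simp add: rayleigh_quotient_def K_def V_def)
  have min: "rayleigh_quotient G f \<le> rayleigh_quotient G g" if "g \<in> test_functions G" for g
    using fmin[OF TK[OF that]] RK[OF f] RK[OF TK[OF that]] RT[OF that] by simp
  moreover have "lambda2 G = rayleigh_quotient G f"
    unfolding lambda2_def using KT[OF f] min by (intro cInf_eq_minimum) auto
  ultimately show ?thesis using KT[OF f] by auto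
qed

definition expander_family :: "'i set \<Rightarrow> ('i \<Rightarrow> 'a ugraph) \<Rightarrow> bool" where
  "expander_family I G \<longleftrightarrow>
     infinite I \<and> (\<forall>i\<in>I. is_ugraph (G i) \<and> finite (verts (G i))) \<and>
     (\<exists>d. \<forall>i\<in>I. degrees_bounded_by d (G i)) \<and>
     (\<exists>c>0. \<forall>i\<in>I. lambda2 (G i) \<ge> c)"

text \<open>The residue classes modulo \<open>n\<close> are represented by \<open>0, \<dots>, n - 1\<close>.\<close>

definition reduce_mod :: "nat \<Rightarrow> int^2 \<Rightarrow> int^2" where
  "reduce_mod n z = (\<chi> i. z $ i mod int n)"

definition torus_verts :: "nat \<Rightarrow> (int^2) set" where
  "torus_verts n = {z. \<forall>i. z $ i \<in> {0..<int n}}"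

definition torus_graph :: "int^2^2 \<Rightarrow> nat \<Rightarrow> (int^2) ugraph" where
  "torus_graph S n =
     (torus_verts n,
      \<Union>z\<in>torus_verts n.
        {{z, reduce_mod n (z + vector [1, 0])}, {z, reduce_mod n (z + vector [0, 1])},
         {z, reduce_mod n (S *v z)}, {z, reduce_mod n (transpose S *v z)}})"

definition lattice_graph :: "int^2^2 \<Rightarrow> (int^2) ugraph" where
  "lattice_graph S = (UNIV - {0}, \<Union>z\<in>UNIV - {0}. {{z, S *v z}, {z, transpose S *v z}})"

end

(* The Fourier transform on (Z/n)^2 turns the translation energy of f into a weight on
   |F|^2, F = dft f, that is bounded below away from the frequency 0, and turns composition
   with S into composition with the transpose of S.

   If the lattice graph expands, cut |F| off to the fundamental box (-n/2, n/2]^2 and regard it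
   as a function on Z^2 - {0}, where Cheeger's inequality applies. An edge of the lattice that
   leaves the box starts at a high frequency, so its contribution is paid for by the translation
   energy.

   Conversely, a finite set U of Z^2 - {0} with small boundary yields, through the Fourier
   transform of its indicator modulo n, test functions of small Rayleigh quotient: as n grows,
   U consists of low frequencies and the translation energy tends to 0. *)

theory Submission
  imports Defs
begin

text \<open>The Fourier transform exchanges the \<open>S\<close>-arrows with the
  \<open>transpose S\<close>-arrows, so having both in the graph makes this part of the energy
  self-dual: it has the same shape for \<open>f\<close> and for \<open>dft n f\<close>. Mean zero
  becomes vanishing at frequency 0, the fixed point that would be a finite set without boundary had
  it not been deleted from the lattice. The obstacle is that frequencies live modulo
  \<open>n\<close> whereas the lattice has no wrap-around. Representatives of least absolute value
  make the reduction invisible as long as the image stays in the box; if it leaves, some coordinate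
  is at least a fixed fraction of \<open>n\<close>, with a fraction that depends on the matrix
  alone. This is what makes the constants uniform in \<open>n\<close>. Absolute values are taken
  because the co-area argument needs a nonnegative function, and they can only lower the energy.
  Fourier analysis produces sums over arrows \<open>(i, z)\<close>, while the graphs have sets of
  unordered edges; arrows may share an edge, so the passage costs factors that depend only on the
  number of maps.\<close>

section \<open>Graphs spanned by finitely many maps\<close>

definition step_graph :: "'a set \<Rightarrow> 'i set \<Rightarrow> ('i \<Rightarrow> 'a \<Rightarrow> 'a) \<Rightarrow> 'a ugraph" where
  "step_graph V I \<phi> = (V, (\<lambda>(i, z). {z, \<phi> i z}) ` (I \<times> V))"

lemma step_graph_UN: "step_graph V I \<phi> = (V, \<Union>z\<in>V. (\<lambda>i. {z, \<phi> i z}) ` I)"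
  unfolding step_graph_def by auto

lemma is_ugraph_step_graph:
  assumes "\<And>i z. i \<in> I \<Longrightarrow> z \<in> V \<Longrightarrow> \<phi> i z \<in> V"
  shows "is_ugraph (step_graph V I \<phi>)"
  unfolding is_ugraph_def step_graph_def
proof (clarsimp)
  fix i z assume "i \<in> I" "z \<in> V"
  then show "\<exists>u\<in>V. \<exists>v\<in>V. {z, \<phi> i z} = {u, v}" using assms by blast
qed

text \<open>An edge at \<open>v\<close> is spanned by an arrow that starts or ends at
  \<open>v\<close>; by injectivity each map contributes at most one edge of either kind.\<close>

lemma degrees_bounded_by_step_graph:
  assumes I: "finite I" and inj: "\<And>i. i \<in> I \<Longrightarrow> inj_on (\<phi> i) V"
  shows "degrees_bounded_by (2 * card I) (step_graph V I \<phi>)"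
  unfolding degrees_bounded_by_def
proof (intro ballI)
  fix v
  let ?X = "{e \<in> edges (step_graph V I \<phi>). v \<in> e}"
  let ?Y = "(\<lambda>i. {v, \<phi> i v}) ` I \<union> (\<lambda>i. {inv_into V (\<phi> i) v, v}) ` I"
  have sub: "?X \<subseteq> ?Y"
  proof
    fix e assume "e \<in> ?X"
    then obtain i z where iz: "i \<in> I" "z \<in> V" "e = {z, \<phi> i z}" and "v = z \<or> v = \<phi> i z"
      by (auto simp: step_graph_def)
    then have "e = {v, \<phi> i v} \<or> e = {inv_into V (\<phi> i) v, v}"
      using inv_into_f_f[OF inj[OF iz(1)] iz(2)] by auto
    then show "e \<in> ?Y" using iz(1) by blast
  qed
  have fin: "finite ?Y" using I by simp
  have "card ?X \<le> card ?Y" using sub fin by (rule card_mono[rotated])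
  also have "\<dots> \<le> card ((\<lambda>i. {v, \<phi> i v}) ` I) + card ((\<lambda>i. {inv_into V (\<phi> i) v, v}) ` I)"
    by (rule card_Un_le)
  also have "\<dots> \<le> card I + card I"
    using I by (intro add_mono card_image_le)
  finally show "finite ?X \<and> card ?X \<le> 2 * card I"
    using finite_subset[OF sub fin] by simp
qed

lemma step_graph_energy_le:
  assumes "finite I" "finite V"
  shows "(\<Sum>e\<in>edges (step_graph V I \<phi>). edge_energy f e)
       \<le> (\<Sum>i\<in>I. \<Sum>z\<in>V. (cmod (f z - f (\<phi> i z)))\<^sup>2)"
proof -
  let ?h = "\<lambda>(i, z). {z, \<phi> i z}"
  have "(\<Sum>e\<in>?h ` (I \<times> V). edge_energy f e) \<le> (\<Sum>p\<in>I \<times> V. (edge_energy f \<circ> ?h) p)"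
    using assms by (intro sum_image_le) auto
  also have "\<dots> = (\<Sum>i\<in>I. \<Sum>z\<in>V. (cmod (f z - f (\<phi> i z)))\<^sup>2)"
    by (simp add: sum.cartesian_product case_prod_unfold)
  finally show ?thesis by (simp add: step_graph_def)
qed

text \<open>An arrow \<open>(i, z)\<close> that spans \<open>e\<close> has \<open>z \<in> e\<close>,
  so at most \<open>2 * card I\<close> arrows span the same edge.\<close>

lemma step_graph_energy_ge:
  assumes "finite I" "finite V"
  shows "(\<Sum>i\<in>I. \<Sum>z\<in>V. (cmod (f z - f (\<phi> i z)))\<^sup>2)
       \<le> 2 * card I * (\<Sum>e\<in>edges (step_graph V I \<phi>). edge_energy f e)"
proof -
  let ?h = "\<lambda>(i, z). {z, \<phi> i z}"
  let ?E = "edges (step_graph V I \<phi>)"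
  have fibre: "card {p \<in> I \<times> V. ?h p = e} \<le> 2 * card I" if e: "e \<in> ?E" for e
  proof -
    obtain u v where uv: "e = {u, v}" using e by (auto simp: step_graph_def)
    have "{p \<in> I \<times> V. ?h p = e} \<subseteq> I \<times> e" by auto
    then have "card {p \<in> I \<times> V. ?h p = e} \<le> card (I \<times> e)"
      using assms uv by (intro card_mono) auto
    also have "\<dots> = card I * card e" by (rule card_cartesian_product)
    also have "\<dots> \<le> card I * 2" using uv by (intro mult_left_mono) (auto simp: card_insert_if)
    finally show ?thesis by simp
  qed
  have fin: "finite (I \<times> V)" using assms by simp
  have "(\<Sum>i\<in>I. \<Sum>z\<in>V. (cmod (f z - f (\<phi> i z)))\<^sup>2) = (\<Sum>p\<in>I \<times> V. edge_energy f (?h p))"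
    by (simp add: sum.cartesian_product case_prod_unfold)
  also have "\<dots> = (\<Sum>e\<in>?h ` (I \<times> V). \<Sum>p\<in>{p \<in> I \<times> V. ?h p = e}. edge_energy f (?h p))"
    by (rule sum.image_gen[OF fin])
  also have "\<dots> = (\<Sum>e\<in>?E. \<Sum>p\<in>{p \<in> I \<times> V. ?h p = e}. edge_energy f e)"
    by (intro sum.cong) (auto simp: step_graph_def)
  also have "\<dots> = (\<Sum>e\<in>?E. card {p \<in> I \<times> V. ?h p = e} * edge_energy f e)"
    by simp
  also have "\<dots> \<le> (\<Sum>e\<in>?E. (2 * card I) * edge_energy f e)"
  proof (intro sum_mono mult_right_mono)
    fix e assume "e \<in> ?E"
    then show "real (card {p \<in> I \<times> V. ?h p = e}) \<le> 2 * card I"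
      using of_nat_mono[OF fibre[of e], where ?'a = real] by linarith
    show "0 \<le> edge_energy f e" using \<open>e \<in> ?E\<close> by (auto simp: step_graph_def)
  qed
  finally show ?thesis by (simp add: sum_distrib_left)
qed

text \<open>For a fixed map, an arrow leaving \<open>U\<close> is determined by its edge, because
  its source is the only endpoint in \<open>U\<close>; an arrow entering \<open>U\<close> likewise,
  its source being the only endpoint outside. An edge can occur once in each way, hence the factor
  2.\<close>

lemma card_edge_boundary_step_graph:
  assumes I: "finite I" "i \<in> I" and inj: "\<And>i. i \<in> I \<Longrightarrow> inj_on (\<phi> i) V"
    and U: "finite U" "U \<subseteq> V" and im: "\<And>z. z \<in> V \<Longrightarrow> \<phi> i z \<in> V"
  shows "card {z \<in> V. (z \<in> U) \<noteq> (\<phi> i z \<in> U)} \<le> 2 * card (edge_boundary (step_graph V I \<phi>) U)"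
    and "finite {z \<in> V. (z \<in> U) \<noteq> (\<phi> i z \<in> U)}"
proof -
  let ?B = "edge_boundary (step_graph V I \<phi>) U"
  have "?B \<subseteq> (\<Union>u\<in>U. {e \<in> edges (step_graph V I \<phi>). u \<in> e})"
    by (auto simp: edge_boundary_def)
  moreover have "finite {e \<in> edges (step_graph V I \<phi>). u \<in> e}" if "u \<in> U" for u
    using degrees_bounded_by_step_graph[OF I(1) inj] that U
    by (auto simp: degrees_bounded_by_def step_graph_def)
  ultimately have fin: "finite ?B"
    using U by (meson finite_UN finite_subset)
  let ?out = "{z \<in> U. \<phi> i z \<notin> U}" and ?inn = "{z \<in> V - U. \<phi> i z \<in> U}" and ?e = "\<lambda>z. {z, \<phi> i z}"
  have sub: "?e ` ?out \<subseteq> ?B" "?e ` ?inn \<subseteq> ?B"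
    using I(2) U(2) by (auto simp: edge_boundary_def step_graph_def)
  have inj_e: "inj_on ?e ?out" "inj_on ?e ?inn"
    by (auto simp: inj_on_def doubleton_eq_iff)
  have c: "card ?out \<le> card ?B" "card ?inn \<le> card ?B"
    using card_inj_on_le[OF inj_e(1) sub(1) fin] card_inj_on_le[OF inj_e(2) sub(2) fin] by auto
  have f: "finite ?out" "finite ?inn"
    using inj_on_finite[OF inj_e(1) sub(1) fin] inj_on_finite[OF inj_e(2) sub(2) fin] by auto
  have eq: "{z \<in> V. (z \<in> U) \<noteq> (\<phi> i z \<in> U)} = ?out \<union> ?inn" using U by auto
  show "finite {z \<in> V. (z \<in> U) \<noteq> (\<phi> i z \<in> U)}" unfolding eq using f by simp
  show "card {z \<in> V. (z \<in> U) \<noteq> (\<phi> i z \<in> U)} \<le> 2 * card ?B"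
    unfolding eq using card_Un_le[of ?out ?inn] c by linarith
qed

section \<open>Cheeger's inequality\<close>

text \<open>Co-area inequality: induction peels off the lowest level set of \<open>h\<close>.\<close>

lemma coarea_ineq:
  fixes h :: "'a \<Rightarrow> real" and \<epsilon> :: real
  assumes "finite A" "finite J"
    and "\<And>x. x \<in> A \<Longrightarrow> h x \<ge> 0" "\<And>x. x \<notin> A \<Longrightarrow> h x = 0"
    and "\<And>U. U \<subseteq> A \<Longrightarrow> \<epsilon> * card U \<le> card {j \<in> J. (s j \<in> U) \<noteq> (t j \<in> U)}"
  shows "\<epsilon> * (\<Sum>x\<in>A. h x) \<le> (\<Sum>j\<in>J. \<bar>h (s j) - h (t j)\<bar>)"
  using assms
proof (induction "card A" arbitrary: A h rule: less_induct)
  case less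
  show ?case
  proof (cases "A = {}")
    case True
    then show ?thesis by (simp add: sum_nonneg)
  next
    case False
    define m where "m = Min (h ` A)"
    have mle: "m \<le> h x" if "x \<in> A" for x
      using that less.prems(1) by (simp add: m_def)
    have "m \<in> h ` A"
      unfolding m_def using False less.prems(1) by (intro Min_in) auto
    then obtain a where a: "a \<in> A" "h a = m" by auto
    define k where "k = (\<lambda>x. h x - m * indicator A x)"
    have m0: "m \<ge> 0" using a less.prems(3) by auto
    have smaller: "card (A - {a}) < card A"
      using a less.prems(1) by (intro card_Diff1_less)
    have k0: "0 \<le> k x" if "x \<in> A - {a}" for x
      using mle that by (auto simp: k_def)
    have kz: "k x = 0" if "x \<notin> A - {a}" for x
      using that a less.prems(4) by (auto simp: k_def indicator_def)
    have "\<epsilon> * card U \<le> card {j \<in> J. (s j \<in> U) \<noteq> (t j \<in> U)}" if "U \<subseteq> A - {a}" for U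
      using that by (intro less.prems(5)) blast
    then have IH: "\<epsilon> * (\<Sum>x\<in>A - {a}. k x) \<le> (\<Sum>j\<in>J. \<bar>k (s j) - k (t j)\<bar>)"
      using smaller less.prems(1,2) k0 kz by (intro less.hyps) blast+
    have "(\<Sum>x\<in>A. h x) = (\<Sum>x\<in>A. k x) + m * card A"
      by (simp add: k_def sum_subtractf)
    also have "(\<Sum>x\<in>A. k x) = (\<Sum>x\<in>A - {a}. k x)"
      using a less.prems(1) by (subst sum.remove[of _ a]) (auto simp: k_def)
    finally have "\<epsilon> * (\<Sum>x\<in>A. h x) = \<epsilon> * (\<Sum>x\<in>A - {a}. k x) + m * (\<epsilon> * card A)"
      by (simp add: algebra_simps)
    also have "\<dots> \<le> (\<Sum>j\<in>J. \<bar>k (s j) - k (t j)\<bar>) + m * card {j \<in> J. (s j \<in> A) \<noteq> (t j \<in> A)}"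
      using IH m0 less.prems(5) by (intro add_mono mult_left_mono) auto
    also have "m * card {j \<in> J. (s j \<in> A) \<noteq> (t j \<in> A)}
        = (\<Sum>j\<in>J. if (s j \<in> A) \<noteq> (t j \<in> A) then m else 0)"
      using less.prems(2) by (simp add: sum.If_cases Int_def)
    \<comment> \<open>On an arrow that crosses the boundary of \<open>A\<close>, the outer value is
      0 and the inner one at least \<open>m\<close>, so lowering \<open>h\<close> by
      \<open>m\<close> on \<open>A\<close> shortens the jump by exactly \<open>m\<close>; all other
      jumps are unchanged.\<close>
    also have "(\<Sum>j\<in>J. \<bar>k (s j) - k (t j)\<bar>) + \<dots> = (\<Sum>j\<in>J. \<bar>h (s j) - h (t j)\<bar>)"
      unfolding sum.distrib[symmetric]
    proof (intro sum.cong refl)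
      fix j
      show "\<bar>k (s j) - k (t j)\<bar> + (if (s j \<in> A) \<noteq> (t j \<in> A) then m else 0) = \<bar>h (s j) - h (t j)\<bar>"
        using mle[of "s j"] mle[of "t j"] less.prems(4)[of "s j"] less.prems(4)[of "t j"] m0
        by (cases "s j \<in> A"; cases "t j \<in> A") (auto simp: k_def)
    qed
    finally show ?thesis .
  qed
qed

text \<open>\<open>J\<close> lists arrows from \<open>s j\<close> to \<open>t j\<close>; the last
  hypothesis is a degree bound in summed form. The co-area inequality is applied to the square of
  \<open>g\<close>, and each difference of squares is split by AM-GM into a squared jump and a part
  controlled by \<open>D\<close>.\<close>

lemma cheeger_ineq:
  fixes g :: "'a \<Rightarrow> real" and \<epsilon> D :: real
  assumes fin: "finite A" "finite J" and "\<epsilon> > 0" "D > 0"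
    and g: "\<And>x. g x \<ge> 0" "\<And>x. x \<notin> A \<Longrightarrow> g x = 0"
    and exp: "\<And>U. U \<subseteq> A \<Longrightarrow> \<epsilon> * card U \<le> card {j \<in> J. (s j \<in> U) \<noteq> (t j \<in> U)}"
    and D: "(\<Sum>j\<in>J. (g (s j))\<^sup>2 + (g (t j))\<^sup>2) \<le> D * (\<Sum>x\<in>A. (g x)\<^sup>2)"
  shows "\<epsilon>\<^sup>2 * (\<Sum>x\<in>A. (g x)\<^sup>2) \<le> 2 * D * (\<Sum>j\<in>J. (g (s j) - g (t j))\<^sup>2)"
proof -
  let ?N = "\<Sum>x\<in>A. (g x)\<^sup>2" and ?E = "\<Sum>j\<in>J. (g (s j) - g (t j))\<^sup>2"
  \<comment> \<open>the AM-GM parameter that lets half of the left-hand side be absorbed\<close>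
  define \<tau> where "\<tau> = \<epsilon> / (2 * D)"
  have \<tau>: "\<tau> > 0" using assms by (simp add: \<tau>_def)
  have pt: "\<bar>a\<^sup>2 - b\<^sup>2\<bar> \<le> (a - b)\<^sup>2 / (2 * \<tau>) + \<tau> * (a\<^sup>2 + b\<^sup>2)" for a b :: real
  proof -
    have "2 * \<tau> * \<bar>a\<^sup>2 - b\<^sup>2\<bar> = 2 * \<bar>a - b\<bar> * (\<tau> * \<bar>a + b\<bar>)"
      by (simp add: abs_mult[symmetric] power2_eq_square algebra_simps)
    also have "\<dots> \<le> \<bar>a - b\<bar>\<^sup>2 + (\<tau> * \<bar>a + b\<bar>)\<^sup>2"
      using sum_squares_bound[of "\<bar>a - b\<bar>" "\<tau> * \<bar>a + b\<bar>"] by simp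
    also have "\<dots> \<le> (a - b)\<^sup>2 + \<tau>\<^sup>2 * (2 * (a\<^sup>2 + b\<^sup>2))"
      using sum_squares_bound[of a b]
      by (auto simp: power_mult_distrib power2_sum intro!: mult_left_mono)
    finally show ?thesis using \<tau> by (simp add: field_simps power2_eq_square)
  qed
  have "\<epsilon> * ?N \<le> (\<Sum>j\<in>J. \<bar>(g (s j))\<^sup>2 - (g (t j))\<^sup>2\<bar>)"
    using fin g exp by (intro coarea_ineq) auto
  also have "\<dots> \<le> (\<Sum>j\<in>J. (g (s j) - g (t j))\<^sup>2 / (2 * \<tau>) + \<tau> * ((g (s j))\<^sup>2 + (g (t j))\<^sup>2))"
    by (intro sum_mono pt)
  also have "\<dots> = ?E / (2 * \<tau>) + \<tau> * (\<Sum>j\<in>J. (g (s j))\<^sup>2 + (g (t j))\<^sup>2)"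
    by (subst sum.distrib) (simp add: sum_divide_distrib sum_distrib_left)
  also have "\<dots> \<le> ?E / (2 * \<tau>) + \<tau> * (D * ?N)"
    using D \<tau> by simp
  finally have "\<epsilon> * ?N \<le> D * ?E / \<epsilon> + \<epsilon> / 2 * ?N"
    using assms by (simp add: \<tau>_def field_simps)
  then have "\<epsilon> * ?N \<le> 2 * (D * ?E / \<epsilon>)" by simp
  then show ?thesis using \<open>\<epsilon> > 0\<close> by (simp add: field_simps power2_eq_square)
qed

lemma step_graph_cheeger:
  fixes g :: "'a \<Rightarrow> real" and \<epsilon> :: real
  assumes I: "finite I" "I \<noteq> {}" and inj: "\<And>i. i \<in> I \<Longrightarrow> inj (\<phi> i)" and "\<epsilon> > 0"
    and exp: "\<And>U. finite U \<Longrightarrow> U \<subseteq> V \<Longrightarrow> \<epsilon> * card U \<le> card (edge_boundary (step_graph V I \<phi>) U)"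
    and A: "finite A" "A \<subseteq> V" and g: "\<And>x. g x \<ge> 0" "\<And>x. x \<notin> A \<Longrightarrow> g x = 0"
  shows "\<exists>W. finite W \<and> \<epsilon>\<^sup>2 * (\<Sum>x\<in>A. (g x)\<^sup>2) \<le> 4 * card I * (\<Sum>i\<in>I. \<Sum>z\<in>W. (g z - g (\<phi> i z))\<^sup>2)"
proof -
  \<comment> \<open>The sources of all arrows that touch \<open>A\<close>, together with
    \<open>A\<close>; finite because the maps are injective.\<close>
  define W where "W = A \<union> (\<Union>i\<in>I. \<phi> i -` A)"
  have W: "finite W"
    unfolding W_def using I A inj by (auto intro: finite_vimageI)
  let ?N = "\<Sum>x\<in>A. (g x)\<^sup>2"
  have le_N: "(\<Sum>x\<in>X. (g x)\<^sup>2) \<le> ?N" if "finite X" for X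
  proof -
    have "(\<Sum>x\<in>X. (g x)\<^sup>2) = (\<Sum>x\<in>X \<inter> A. (g x)\<^sup>2)"
      using that g(2) by (intro sum.mono_neutral_right) auto
    also have "\<dots> \<le> ?N" using A by (intro sum_mono2) auto
    finally show ?thesis .
  qed
  \<comment> \<open>Every vertex is the source of at most \<open>card I\<close> arrows and, by
    injectivity, the target of at most \<open>card I\<close>.\<close>
  have D: "(\<Sum>j\<in>I \<times> W. (g (snd j))\<^sup>2 + (g (case_prod \<phi> j))\<^sup>2) \<le> (2 * real (card I)) * ?N"
  proof -
    have "(\<Sum>z\<in>W. (g (\<phi> i z))\<^sup>2) \<le> ?N" if "i \<in> I" for i
    proof -
      have "inj_on (\<phi> i) W" using inj[OF that] by (rule inj_on_subset) simp
      then have "(\<Sum>z\<in>W. (g (\<phi> i z))\<^sup>2) = (\<Sum>x\<in>\<phi> i ` W. (g x)\<^sup>2)"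
        by (simp add: sum.reindex)
      then show ?thesis using le_N[of "\<phi> i ` W"] W by simp
    qed
    then have "(\<Sum>i\<in>I. (\<Sum>z\<in>W. (g z)\<^sup>2) + (\<Sum>z\<in>W. (g (\<phi> i z))\<^sup>2)) \<le> (\<Sum>i\<in>I. ?N + ?N)"
      using le_N[OF W] by (intro sum_mono add_mono) auto
    moreover have "(\<Sum>j\<in>I \<times> W. (g (snd j))\<^sup>2 + (g (case_prod \<phi> j))\<^sup>2)
        = (\<Sum>i\<in>I. (\<Sum>z\<in>W. (g z)\<^sup>2) + (\<Sum>z\<in>W. (g (\<phi> i z))\<^sup>2))"
      by (simp add: sum.distrib[symmetric] sum.cartesian_product case_prod_unfold)
    ultimately show ?thesis by simp
  qed
  \<comment> \<open>A boundary edge of \<open>U\<close> is spanned by a crossing arrow, whose source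
    is in \<open>W\<close> because one of its endpoints is in
    \<open>U \<subseteq> A\<close>.\<close>
  have cut: "\<epsilon> * card U \<le> card {j \<in> I \<times> W. (snd j \<in> U) \<noteq> (case_prod \<phi> j \<in> U)}"
    if U: "U \<subseteq> A" for U
  proof -
    let ?C = "{j \<in> I \<times> W. (snd j \<in> U) \<noteq> (case_prod \<phi> j \<in> U)}"
    have finC: "finite ?C" using I W by simp
    have "edge_boundary (step_graph V I \<phi>) U \<subseteq> (\<lambda>(i, z). {z, \<phi> i z}) ` ?C"
    proof
      fix e assume "e \<in> edge_boundary (step_graph V I \<phi>) U"
      then obtain i z u v where iz: "i \<in> I" "e = {z, \<phi> i z}" "{z, \<phi> i z} = {u, v}" "u \<in> U" "v \<notin> U"
        by (auto simp: edge_boundary_def step_graph_def)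
      then have "(z \<in> U) \<noteq> (\<phi> i z \<in> U)" by (auto simp: doubleton_eq_iff)
      moreover from this have "z \<in> W" using U iz(1) by (auto simp: W_def)
      ultimately have "(i, z) \<in> ?C" using iz(1) by simp
      then show "e \<in> (\<lambda>(i, z). {z, \<phi> i z}) ` ?C"
        using iz(2) by (intro image_eqI[of _ _ "(i, z)"]) simp_all
    qed
    then have "card (edge_boundary (step_graph V I \<phi>) U) \<le> card ((\<lambda>(i, z). {z, \<phi> i z}) ` ?C)"
      using finC by (intro card_mono) auto
    also have "\<dots> \<le> card ?C" by (rule card_image_le[OF finC])
    finally have "real (card (edge_boundary (step_graph V I \<phi>) U)) \<le> real (card ?C)"
      by (rule of_nat_mono)
    moreover have "\<epsilon> * card U \<le> card (edge_boundary (step_graph V I \<phi>) U)"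
      using U A by (intro exp) (auto intro: finite_subset)
    ultimately show ?thesis by linarith
  qed
  have "\<epsilon>\<^sup>2 * ?N \<le> 2 * (2 * real (card I)) * (\<Sum>j\<in>I \<times> W. (g (snd j) - g (case_prod \<phi> j))\<^sup>2)"
    using I A W \<open>\<epsilon> > 0\<close> g cut D
    by (intro cheeger_ineq) (auto simp: card_gt_0_iff)
  also have "(\<Sum>j\<in>I \<times> W. (g (snd j) - g (case_prod \<phi> j))\<^sup>2) = (\<Sum>i\<in>I. \<Sum>z\<in>W. (g z - g (\<phi> i z))\<^sup>2)"
    by (simp add: sum.cartesian_product case_prod_unfold)
  finally show ?thesis using W by auto
qed

section \<open>The discrete torus\<close>

lemma torus_verts_iff: "z \<in> torus_verts n \<longleftrightarrow> (\<forall>i. 0 \<le> z $ i \<and> z $ i < int n)"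
  by (simp add: torus_verts_def)

lemma reduce_mod_in: "n > 0 \<Longrightarrow> reduce_mod n z \<in> torus_verts n"
  by (simp add: torus_verts_iff reduce_mod_def)

lemma reduce_mod_id: "z \<in> torus_verts n \<Longrightarrow> reduce_mod n z = z"
  by (simp add: torus_verts_iff reduce_mod_def vec_eq_iff)

lemma reduce_mod_idem [simp]: "reduce_mod n (reduce_mod n z) = reduce_mod n z"
  by (simp add: reduce_mod_def)

lemma reduce_mod_eq_iff: "reduce_mod n x = reduce_mod n y \<longleftrightarrow> (\<forall>i. int n dvd x $ i - y $ i)"
  by (simp add: reduce_mod_def vec_eq_iff mod_eq_dvd_iff)

lemma reduce_mod_add: "reduce_mod n (reduce_mod n x + y) = reduce_mod n (x + y)"
  by (simp add: reduce_mod_def vec_eq_iff mod_simps)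

lemma reduce_mod_mult: "reduce_mod n (A *v reduce_mod n z) = reduce_mod n (A *v z)"
proof -
  have "int n dvd (z $ i mod int n) - z $ i" for i
    by (metis mod_eq_dvd_iff mod_mod_trivial)
  then have "int n dvd A $ i $ j * ((z $ j mod int n) - z $ j)" for i j by simp
  then show ?thesis
    unfolding reduce_mod_eq_iff
    by (auto simp: matrix_vector_mult_def sum_subtractf[symmetric]
        right_diff_distrib[symmetric] reduce_mod_def intro!: dvd_sum)
qed

lemma bij_torus_coords:
  "bij_betw (\<lambda>z::int^2. (z $ 1, z $ 2)) (torus_verts n) ({0..<int n} \<times> {0..<int n})"
  by (rule bij_betw_byWitness[where f' = "\<lambda>(x, y). vector [x, y]"])
     (auto simp: torus_verts_iff vec_eq_iff forall_2)

lemma finite_torus_verts [simp]: "finite (torus_verts n)"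
  using bij_betw_finite[OF bij_torus_coords] by simp

lemma card_torus_verts: "card (torus_verts n) = n\<^sup>2"
  using bij_betw_same_card[OF bij_torus_coords, of n] by (simp add: power2_eq_square)

lemma bij_torus_add:
  assumes "n > 0"
  shows "bij_betw (\<lambda>z. reduce_mod n (z + a)) (torus_verts n) (torus_verts n)"
proof (rule bij_betw_byWitness[where f' = "\<lambda>z. reduce_mod n (z + (- a))"])
qed (use assms in \<open>auto simp: reduce_mod_add reduce_mod_id reduce_mod_in simp del: add_uminus_conv_diff\<close>)

lemma bij_torus_mult:
  assumes "n > 0" "A ** B = mat 1" "B ** A = mat 1"
  shows "bij_betw (\<lambda>z. reduce_mod n (A *v z)) (torus_verts n) (torus_verts n)"
proof (rule bij_betw_byWitness[where f' = "\<lambda>z. reduce_mod n (B *v z)"])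
qed (use assms in \<open>auto simp: reduce_mod_mult reduce_mod_id reduce_mod_in matrix_vector_mul_assoc\<close>)

text \<open>Functions on the quotient are kept as periodic functions on the whole lattice, so that
  translations and matrices act on the argument without \<open>reduce_mod\<close>.\<close>

definition periodic :: "nat \<Rightarrow> (int^2 \<Rightarrow> 'a) \<Rightarrow> bool" where
  "periodic n h \<longleftrightarrow> (\<forall>z. h (reduce_mod n z) = h z)"

lemma periodicD: "periodic n h \<Longrightarrow> h (reduce_mod n z) = h z"
  by (simp add: periodic_def)

lemma periodic_cong: "periodic n h \<Longrightarrow> reduce_mod n x = reduce_mod n y \<Longrightarrow> h x = h y"
  by (metis periodicD)

lemma periodic_comp_mult: "periodic n h \<Longrightarrow> periodic n (\<lambda>z. h (A *v z))"
  unfolding periodic_def[of n "\<lambda>z. h (A *v z)"]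
  by (intro allI periodic_cong[of n h] reduce_mod_mult)

lemma sum_torus_add:
  assumes "n > 0" "periodic n h"
  shows "(\<Sum>z\<in>torus_verts n. h (z + a)) = (\<Sum>z\<in>torus_verts n. h z)"
  using sum.reindex_bij_betw[OF bij_torus_add[OF assms(1)], of h a] assms(2)
  by (simp add: periodicD)

lemma sum_torus_mult:
  assumes "n > 0" "periodic n h" "A ** B = mat 1" "B ** A = mat 1"
  shows "(\<Sum>z\<in>torus_verts n. h (A *v z)) = (\<Sum>z\<in>torus_verts n. h z)"
  using sum.reindex_bij_betw[OF bij_torus_mult[OF assms(1,3,4)], of h] assms(2)
  by (simp add: periodicD)

section \<open>Fourier analysis on the discrete torus\<close>

definition idot :: "int^2 \<Rightarrow> int^2 \<Rightarrow> int" where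
  "idot x y = (\<Sum>i\<in>UNIV. x $ i * y $ i)"

lemma idot_commute: "idot x y = idot y x"
  by (simp add: idot_def mult.commute)

lemma idot_add: "idot x (y + z) = idot x y + idot x z"
  by (simp add: idot_def sum.distrib algebra_simps)

lemma idot_add_left: "idot (x + y) z = idot x z + idot y z"
  by (simp add: idot_def sum.distrib algebra_simps)

lemma idot_minus: "idot x (- y) = - idot x y"
  by (simp add: idot_def sum_negf)

lemma idot_zero [simp]: "idot 0 x = 0" "idot x 0 = 0"
  by (simp_all add: idot_def)

lemma idot_transpose: "idot (transpose A *v x) y = idot x (A *v y)"
  by (simp add: idot_def UNIV_2 matrix_vector_mult_def transpose_def algebra_simps)

lemma idot_cong:
  assumes "reduce_mod n x = reduce_mod n y"
  shows "int n dvd idot x z - idot y z"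
  using assms
  by (auto simp: idot_def reduce_mod_eq_iff sum_subtractf[symmetric]
      left_diff_distrib[symmetric] intro!: dvd_sum)

definition chr :: "nat \<Rightarrow> int \<Rightarrow> complex" where
  "chr n k = cis (2 * pi * of_int k / of_nat n)"

lemma chr_add: "chr n (a + b) = chr n a * chr n b"
  by (simp add: chr_def cis_mult add_divide_distrib distrib_left)

lemma chr_zero [simp]: "chr n 0 = 1"
  by (simp add: chr_def)

lemma cnj_chr: "cnj (chr n k) = chr n (- k)"
  by (simp add: chr_def cis_cnj)

lemma norm_chr [simp]: "cmod (chr n k) = 1"
  by (simp add: chr_def)

lemma chr_eq_1:
  assumes "n > 0" "int n dvd k"
  shows "chr n k = 1"
proof -
  obtain j where "k = int n * j" using assms(2) by auto
  then have "2 * pi * of_int k / of_nat n = 2 * pi * of_int j" using assms(1) by simp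
  then show ?thesis by (simp add: chr_def cis_multiple_2pi)
qed

lemma chr_cong:
  assumes "n > 0" "int n dvd a - b"
  shows "chr n a = chr n b"
  using chr_add[of n "a - b" b] chr_eq_1[OF assms] by simp

lemma norm_1_minus_chr: "(cmod (1 - chr n k))\<^sup>2 = 4 * (sin (pi * of_int k / of_nat n))\<^sup>2"
proof -
  define x where "x = pi * of_int k / of_nat n"
  have "chr n k = cis (2 * x)" by (simp add: chr_def x_def mult.assoc)
  then have "(cmod (1 - chr n k))\<^sup>2 = (1 - cos (2 * x))\<^sup>2 + (sin (2 * x))\<^sup>2"
    by (simp add: cmod_power2)
  also have "\<dots> = 2 - 2 * cos (2 * x)"
    using sin_cos_squared_add2[of "2 * x"] by (simp add: power2_eq_square algebra_simps)
  also have "\<dots> = 4 * (sin x)\<^sup>2" by (simp add: cos_double_sin)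
  finally show ?thesis by (simp add: x_def)
qed

lemma chr_neq_1:
  assumes "0 < k" "k < int n"
  shows "chr n k \<noteq> 1"
proof -
  have "sin (pi * of_int k / of_nat n) > 0"
    using assms by (intro sin_gt_zero) (auto simp: field_simps)
  then show ?thesis using norm_1_minus_chr[of n k] by auto
qed

lemma periodic_chr: "n > 0 \<Longrightarrow> periodic n (\<lambda>z. chr n (idot z a))"
  unfolding periodic_def by (intro allI chr_cong idot_cong) auto

text \<open>Orthogonality of characters: translating the summation variable by a unit vector
  multiplies the sum by a character value, and for a nontrivial character one of these values
  differs from 1.\<close>

lemma sum_chr:
  assumes "n > 0"
  shows "(\<Sum>m\<in>torus_verts n. chr n (idot m d))
       = (if reduce_mod n d = 0 then of_nat (n\<^sup>2) else 0)"
proof (cases "reduce_mod n d = 0")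
  case True
  then have "reduce_mod n d = reduce_mod n 0" by (simp add: reduce_mod_def vec_eq_iff)
  then have "chr n (idot m d) = 1" for m
    using idot_cong[of n d 0 m] assms by (intro chr_eq_1) (auto simp: idot_commute)
  then show ?thesis using True by (simp add: card_torus_verts)
next
  case False
  then obtain i where i: "d $ i mod int n \<noteq> 0"
    by (auto simp: reduce_mod_def vec_eq_iff)
  define c where "c = chr n (d $ i)"
  have "c = chr n (d $ i mod int n)"
    unfolding c_def using assms by (intro chr_cong) (auto simp: mod_eq_dvd_iff[symmetric])
  also have "\<dots> \<noteq> 1"
    using i assms pos_mod_sign[of "int n" "d $ i"] pos_mod_bound[of "int n" "d $ i"]
    by (intro chr_neq_1) linarith+
  finally have c: "c \<noteq> 1" .
  have ax: "idot (axis i 1) d = d $ i"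
    using exhaust_2[of i] by (auto simp: idot_def UNIV_2 axis_def)
  have "(\<Sum>m\<in>torus_verts n. chr n (idot m d)) = (\<Sum>m\<in>torus_verts n. chr n (idot (m + axis i 1) d))"
    using sum_torus_add[OF assms periodic_chr[OF assms, of d]] by simp
  also have "\<dots> = c * (\<Sum>m\<in>torus_verts n. chr n (idot m d))"
    by (simp add: idot_add_left ax chr_add c_def sum_distrib_left mult.commute)
  finally show ?thesis using c False by simp
qed

text \<open>Unnormalised, so Parseval carries the factor \<open>n^2\<close>.\<close>

definition dft :: "nat \<Rightarrow> (int^2 \<Rightarrow> complex) \<Rightarrow> int^2 \<Rightarrow> complex" where
  "dft n f m = (\<Sum>z\<in>torus_verts n. f z * chr n (idot m z))"

lemma periodic_dft: "n > 0 \<Longrightarrow> periodic n (dft n f)"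
  unfolding periodic_def dft_def
  by (intro allI sum.cong arg_cong2[of _ _ _ _ "(*)"] refl chr_cong idot_cong) auto

lemma dft_diff: "dft n (\<lambda>z. f z - g z) m = dft n f m - dft n g m"
  by (simp add: dft_def sum_subtractf algebra_simps)

text \<open>After expanding the square and summing over \<open>m\<close> first, orthogonality leaves
  only the diagonal \<open>z = w\<close>.\<close>

lemma parseval:
  assumes "n > 0"
  shows "(\<Sum>m\<in>torus_verts n. (cmod (dft n f m))\<^sup>2) = n\<^sup>2 * (\<Sum>z\<in>torus_verts n. (cmod (f z))\<^sup>2)"
proof -
  let ?V = "torus_verts n"
  have sq: "of_real ((cmod (dft n f m))\<^sup>2)
      = (\<Sum>z\<in>?V. \<Sum>w\<in>?V. f z * cnj (f w) * chr n (idot m (z - w)))" for m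
  proof -
    have "of_real ((cmod (dft n f m))\<^sup>2) = dft n f m * cnj (dft n f m)"
      by (rule complex_norm_square)
    also have "\<dots> = (\<Sum>z\<in>?V. \<Sum>w\<in>?V. (f z * chr n (idot m z)) * cnj (f w * chr n (idot m w)))"
      by (simp add: dft_def sum_product)
    finally show ?thesis
      by (simp add: cnj_chr diff_conv_add_uminus idot_add idot_minus chr_add mult_ac
          del: add_uminus_conv_diff)
  qed
  have eq: "reduce_mod n (z - w) = 0 \<longleftrightarrow> z = w" if "z \<in> ?V" "w \<in> ?V" for z w
  proof -
    have "reduce_mod n (z - w) = 0 \<longleftrightarrow> reduce_mod n z = reduce_mod n w"
      by (simp add: reduce_mod_eq_iff) (auto simp: reduce_mod_def vec_eq_iff dvd_eq_mod_eq_0)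
    then show ?thesis using that by (simp add: reduce_mod_id)
  qed
  have "complex_of_real (\<Sum>m\<in>?V. (cmod (dft n f m))\<^sup>2)
      = (\<Sum>m\<in>?V. \<Sum>z\<in>?V. \<Sum>w\<in>?V. f z * cnj (f w) * chr n (idot m (z - w)))"
    unfolding of_real_sum sq ..
  also have "\<dots> = (\<Sum>z\<in>?V. \<Sum>w\<in>?V. \<Sum>m\<in>?V. f z * cnj (f w) * chr n (idot m (z - w)))"
    by (rule trans[OF sum.swap], rule sum.cong[OF refl], rule sum.swap)
  also have "\<dots> = (\<Sum>z\<in>?V. \<Sum>w\<in>?V. if z = w then f z * cnj (f w) * of_nat (n\<^sup>2) else 0)"
    using assms by (intro sum.cong refl) (simp add: sum_distrib_left[symmetric] sum_chr eq)
  also have "\<dots> = (\<Sum>z\<in>?V. f z * cnj (f z) * of_nat (n\<^sup>2))"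
    by simp
  also have "\<dots> = complex_of_real (n\<^sup>2 * (\<Sum>z\<in>?V. (cmod (f z))\<^sup>2))"
    by (simp add: complex_norm_square[symmetric] sum_distrib_left mult.commute)
  finally show ?thesis by (simp only: of_real_eq_iff of_nat_power)
qed

text \<open>Substitute \<open>A *v z\<close> for \<open>z\<close> and move \<open>A\<close> across
  the pairing; the substitution leaves the inverse \<open>B\<close> inside \<open>f\<close>.\<close>

lemma dft_mult:
  assumes "n > 0" "periodic n f" "A ** B = mat 1" "B ** A = mat 1"
  shows "dft n f (transpose A *v m) = dft n (\<lambda>z. f (B *v z)) m"
proof -
  have per: "periodic n (\<lambda>z. f (B *v z) * chr n (idot m z))"
    using periodicD[OF periodic_comp_mult[OF assms(2)]] periodicD[OF periodic_chr[OF assms(1)]]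
    by (simp add: periodic_def idot_commute[of m])
  have "dft n (\<lambda>z. f (B *v z)) m = (\<Sum>z\<in>torus_verts n. f (B *v (A *v z)) * chr n (idot m (A *v z)))"
    unfolding dft_def by (rule sum_torus_mult[OF assms(1) per assms(3,4), symmetric])
  then show ?thesis
    by (simp add: dft_def idot_transpose matrix_vector_mul_assoc assms del: transpose_matrix_vector)
qed

text \<open>By \<open>dft_mult\<close> the left side is the Parseval norm of the difference of
  \<open>f\<close> and its composition with \<open>B\<close>; one more substitution by
  \<open>A\<close> removes the inverse.\<close>

lemma dft_mult_energy:
  assumes "n > 0" "periodic n f" "A ** B = mat 1" "B ** A = mat 1"
  shows "(\<Sum>m\<in>torus_verts n. (cmod (dft n f m - dft n f (transpose A *v m)))\<^sup>2)
       = n\<^sup>2 * (\<Sum>z\<in>torus_verts n. (cmod (f z - f (A *v z)))\<^sup>2)"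
proof -
  have per: "periodic n (\<lambda>z. (cmod (f z - f (B *v z)))\<^sup>2)"
    using assms(2) periodic_comp_mult[OF assms(2), of B] by (simp add: periodic_def)
  have "(\<Sum>z\<in>torus_verts n. (cmod (f z - f (B *v z)))\<^sup>2)
      = (\<Sum>z\<in>torus_verts n. (cmod (f (A *v z) - f (B *v (A *v z))))\<^sup>2)"
    by (rule sum_torus_mult[OF assms(1) per assms(3,4), symmetric])
  also have "\<dots> = (\<Sum>z\<in>torus_verts n. (cmod (f z - f (A *v z)))\<^sup>2)"
    by (simp add: matrix_vector_mul_assoc assms norm_minus_commute)
  finally show ?thesis
    using parseval[OF assms(1), of "\<lambda>z. f z - f (B *v z)"]
    by (simp add: dft_diff dft_mult[OF assms] del: transpose_matrix_vector)
qed

text \<open>Translating the frequency amounts to modulating the function. This serves the converse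
  direction, where the test function is itself a transform.\<close>

lemma dft_modulate_energy:
  assumes "n > 0"
  shows "(\<Sum>m\<in>torus_verts n. (cmod (dft n f m - dft n f (m + a)))\<^sup>2)
       = n\<^sup>2 * (\<Sum>z\<in>torus_verts n. (cmod (1 - chr n (idot z a)))\<^sup>2 * (cmod (f z))\<^sup>2)"
proof -
  have "dft n f (m + a) = dft n (\<lambda>z. f z * chr n (idot z a)) m" for m
    by (simp add: dft_def idot_add_left chr_add idot_commute[of a] mult_ac)
  moreover have "f z - f z * c = (1 - c) * f z" for z c by (simp add: algebra_simps)
  ultimately show ?thesis
    using parseval[OF assms, of "\<lambda>z. f z - f z * chr n (idot z a)"]
    by (simp add: dft_diff[symmetric] norm_mult power_mult_distrib)
qed

text \<open>Translating the function multiplies its transform by a number of modulus 1, and Parseval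
  is applied to the difference.\<close>

lemma dft_shift_energy:
  assumes "n > 0" "periodic n f"
  shows "(\<Sum>m\<in>torus_verts n. (cmod (1 - chr n (idot m a)))\<^sup>2 * (cmod (dft n f m))\<^sup>2)
       = n\<^sup>2 * (\<Sum>z\<in>torus_verts n. (cmod (f z - f (z + a)))\<^sup>2)"
proof -
  have shift: "dft n (\<lambda>z. f (z + a)) m * chr n (idot m a) = dft n f m" for m
  proof -
    have per: "periodic n (\<lambda>z. f z * chr n (idot m z))"
      using periodicD[OF assms(2)] periodicD[OF periodic_chr[OF assms(1)]]
      by (simp add: periodic_def idot_commute[of m])
    have "(\<Sum>z\<in>torus_verts n. f (z + a) * chr n (idot m (z + a))) = dft n f m"
      unfolding dft_def by (rule sum_torus_add[OF assms(1) per])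
    then show ?thesis by (simp add: dft_def idot_add chr_add sum_distrib_right mult.assoc)
  qed
  have "(cmod (1 - chr n (idot m a)))\<^sup>2 * (cmod (dft n f m))\<^sup>2
      = (cmod (dft n (\<lambda>z. f z - f (z + a)) m))\<^sup>2" for m
  proof -
    let ?c = "chr n (idot m a)" and ?G = "dft n (\<lambda>z. f (z + a)) m"
    have "dft n (\<lambda>z. f z - f (z + a)) m = ?G * ?c - ?G"
      by (simp add: dft_diff shift)
    also have "\<dots> = - (1 - ?c) * ?G" by (simp add: algebra_simps)
    finally have "cmod (dft n (\<lambda>z. f z - f (z + a)) m) = cmod (1 - ?c) * cmod ?G"
      by (simp add: norm_mult norm_minus_commute)
    moreover have "cmod ?G = cmod (dft n f m)"
      by (simp add: norm_mult flip: shift[of m])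
    ultimately show ?thesis by (simp add: power_mult_distrib)
  qed
  then show ?thesis using parseval[OF assms(1)] by simp
qed

section \<open>Low and high frequencies\<close>

text \<open>The eigenvalue, at the character of frequency \<open>z\<close>, of the Laplacian of the
  two unit translations; hence the weight that the translation energy puts on that
  frequency.\<close>

definition freq :: "nat \<Rightarrow> int^2 \<Rightarrow> real" where
  "freq n z = (\<Sum>i\<in>UNIV. (cmod (1 - chr n (z $ i)))\<^sup>2)"

lemma freq_nonneg: "freq n z \<ge> 0"
  by (simp add: freq_def sum_nonneg)

lemma periodic_freq:
  assumes "n > 0"
  shows "periodic n (freq n)"
  unfolding periodic_def freq_def
proof (intro allI sum.cong refl)
  fix z :: "int^2" and i
  have "chr n (reduce_mod n z $ i) = chr n (z $ i)"
    by (intro chr_cong[OF assms]) (metis mod_eq_dvd_iff mod_mod_trivial reduce_mod_def vec_lambda_beta)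
  then show "(cmod (1 - chr n (reduce_mod n z $ i)))\<^sup>2 = (cmod (1 - chr n (z $ i)))\<^sup>2" by simp
qed

text \<open>From \<open>\<bar>sin x\<bar> \<le> \<bar>x\<bar>\<close>. A fixed frequency thus has
  weight of order \<open>1 / n^2\<close>.\<close>

lemma freq_upper: "freq n z \<le> (2 * pi / n)\<^sup>2 * (\<Sum>i\<in>UNIV. (of_int (z $ i))\<^sup>2)"
proof -
  have "(cmod (1 - chr n k))\<^sup>2 \<le> (2 * pi / n)\<^sup>2 * (of_int k)\<^sup>2" for k
  proof -
    let ?x = "pi * of_int k / of_nat n :: real"
    have "(sin ?x)\<^sup>2 \<le> ?x\<^sup>2"
      using abs_sin_x_le_abs_x[of ?x] by (simp only: abs_le_square_iff)
    then have "(cmod (1 - chr n k))\<^sup>2 \<le> 4 * ?x\<^sup>2" by (simp add: norm_1_minus_chr)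
    also have "\<dots> = (2 * pi / n)\<^sup>2 * (of_int k)\<^sup>2" by (simp add: power_mult_distrib power_divide)
    finally show ?thesis .
  qed
  then show ?thesis unfolding freq_def sum_distrib_left by (intro sum_mono)
qed

text \<open>Residues of least absolute value; one inequality is strict so that for even
  \<open>n\<close> the class of \<open>n / 2\<close> keeps a single representative.\<close>

definition box :: "nat \<Rightarrow> (int^2) set" where
  "box n = {z. \<forall>i. - int n < 2 * z $ i \<and> 2 * z $ i \<le> int n}"

lemma bij_box_torus:
  assumes "n > 0"
  shows "bij_betw (reduce_mod n) (box n) (torus_verts n)"
proof (rule bij_betw_byWitness[where f' = "\<lambda>z. \<chi> i. if 2 * z $ i \<le> int n then z $ i else z $ i - int n"])
  have m: "x mod int n = (if 0 \<le> x then x else x + int n)" if "- int n < 2 * x" "2 * x \<le> int n" for x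
  proof (cases "0 \<le> x")
    case True
    then show ?thesis using that assms by simp
  next
    case False
    then have "x mod int n = (x + int n) mod int n" by simp
    also have "\<dots> = x + int n" using False that by (intro mod_pos_pos_trivial) auto
    finally show ?thesis using False by simp
  qed
  have lift: "(if 2 * (x mod int n) \<le> int n then x mod int n else x mod int n - int n) = x"
    if "- int n < 2 * x" "2 * x \<le> int n" for x
    unfolding m[OF that] using that by auto
  show "\<forall>z\<in>box n. (\<chi> i. if 2 * reduce_mod n z $ i \<le> int n then reduce_mod n z $ i
      else reduce_mod n z $ i - int n) = z"
    by (simp add: box_def reduce_mod_def vec_eq_iff lift cong: if_cong split del: if_split)
  show "\<forall>z\<in>torus_verts n. reduce_mod n (\<chi> i. if 2 * z $ i \<le> int n then z $ i else z $ i - int n) = z"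
    by (auto simp: torus_verts_iff reduce_mod_def vec_eq_iff)
  show "reduce_mod n ` box n \<subseteq> torus_verts n" using assms by (auto intro: reduce_mod_in)
  show "(\<lambda>z. \<chi> i. if 2 * z $ i \<le> int n then z $ i else z $ i - int n) ` torus_verts n \<subseteq> box n"
    using assms by (auto simp: torus_verts_iff box_def) (smt (verit, best))+
qed

lemma finite_box [simp]: "n > 0 \<Longrightarrow> finite (box n)"
  using bij_betw_finite[OF bij_box_torus] by simp

lemma sum_box:
  assumes "n > 0" "periodic n h"
  shows "(\<Sum>z\<in>box n. h z) = (\<Sum>z\<in>torus_verts n. h z)"
  using sum.reindex_bij_betw[OF bij_box_torus[OF assms(1)], of h] assms(2)
  by (simp add: periodicD)

text \<open>The box keeps the angle \<open>pi * \<bar>z $ i\<bar> / n\<close> at most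
  \<open>pi / 2\<close>, where sine is increasing, and the last hypothesis keeps it at least
  \<open>pi / (2 * K)\<close>.\<close>

lemma freq_lower_coord:
  fixes K :: real
  assumes "n > 0" "z \<in> box n" "K \<ge> 1" "n \<le> 2 * K * \<bar>of_int (z $ i)\<bar>"
  shows "4 * (sin (pi / (2 * K)))\<^sup>2 \<le> freq n z"
proof -
  let ?a = "\<bar>of_int (z $ i)\<bar> :: real"
  have "- int n < 2 * z $ i" "2 * z $ i \<le> int n" using assms(2) by (auto simp: box_def)
  then have "2 * \<bar>z $ i\<bar> \<le> int n" by linarith
  then have "real_of_int (2 * \<bar>z $ i\<bar>) \<le> real_of_int (int n)" by (rule of_int_le_iff[THEN iffD2])
  then have a: "2 * ?a \<le> n" by simp
  have x: "pi / (2 * K) \<le> pi * ?a / n" "pi * ?a / n \<le> pi / 2" "0 \<le> pi / (2 * K)"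
    using assms a by (auto simp: field_simps)
  moreover have "- (pi / 2) \<le> pi / (2 * K)" using x(3) pi_gt_zero by linarith
  ultimately have "sin (pi / (2 * K)) \<le> sin (pi * ?a / n)"
    by (intro sin_monotone_2pi_le)
  moreover have "sin (pi / (2 * K)) \<ge> 0"
    using assms(3) by (intro sin_ge_zero) (auto simp: field_simps)
  ultimately have "(sin (pi / (2 * K)))\<^sup>2 \<le> (sin (pi * ?a / n))\<^sup>2" by (rule power_mono)
  also have "\<dots> = (sin (pi * of_int (z $ i) / n))\<^sup>2" by (auto simp: abs_if)
  finally have "4 * (sin (pi / (2 * K)))\<^sup>2 \<le> (cmod (1 - chr n (z $ i)))\<^sup>2"
    by (simp add: norm_1_minus_chr)
  also have "\<dots> \<le> freq n z" unfolding freq_def by (intro member_le_sum) auto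
  finally show ?thesis .
qed

text \<open>Outside the box some coordinate of \<open>A *v z\<close> is at least
  \<open>n / 2\<close> in absolute value, so some coordinate of \<open>z\<close> is at least
  \<open>n / (2 * L)\<close>, where \<open>L\<close> depends only on the entries of
  \<open>A\<close>.\<close>

lemma freq_lower_exit:
  fixes A :: "int^2^2"
  shows "\<exists>\<kappa>>0. \<forall>n z. n > 0 \<longrightarrow> z \<in> box n \<longrightarrow> A *v z \<notin> box n \<longrightarrow> \<kappa> \<le> freq n z"
proof -
  \<comment> \<open>The summand 1 gives \<open>L \<ge> 1\<close> for every \<open>A\<close>, which
    puts \<open>pi / (2 * L)\<close> where sine is positive.\<close>
  define L where "L = 1 + (\<Sum>i\<in>UNIV. \<Sum>j\<in>UNIV. \<bar>A $ i $ j\<bar>)"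
  have L: "\<bar>A $ i $ 1\<bar> + \<bar>A $ i $ 2\<bar> \<le> L" "L \<ge> 1" for i
    using exhaust_2[of i] by (auto simp: L_def UNIV_2)
  define \<kappa> where "\<kappa> = 4 * (sin (pi / (2 * of_int L)))\<^sup>2"
  have "sin (pi / (2 * of_int L)) > 0"
    using L(2) by (intro sin_gt_zero) (auto simp: field_simps)
  then have "\<kappa> > 0" by (simp add: \<kappa>_def)
  moreover have "\<kappa> \<le> freq n z" if n: "n > 0" and z: "z \<in> box n" and Az: "A *v z \<notin> box n" for n z
  proof -
    obtain j where "\<not> (- int n < 2 * (A *v z) $ j \<and> 2 * (A *v z) $ j \<le> int n)"
      using Az by (auto simp: box_def)
    then have j: "int n \<le> 2 * \<bar>(A *v z) $ j\<bar>" by linarith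
    define M where "M = max \<bar>z $ 1\<bar> \<bar>z $ 2\<bar>"
    have "(A *v z) $ j = A $ j $ 1 * z $ 1 + A $ j $ 2 * z $ 2"
      by (simp add: matrix_vector_mult_def UNIV_2)
    then have "\<bar>(A *v z) $ j\<bar> \<le> \<bar>A $ j $ 1\<bar> * \<bar>z $ 1\<bar> + \<bar>A $ j $ 2\<bar> * \<bar>z $ 2\<bar>"
      by (metis abs_mult abs_triangle_ineq)
    also have "\<dots> \<le> \<bar>A $ j $ 1\<bar> * M + \<bar>A $ j $ 2\<bar> * M"
      by (intro add_mono mult_left_mono) (auto simp: M_def)
    also have "\<dots> \<le> L * M"
      using L(1)[of j] by (simp add: distrib_right[symmetric] mult_right_mono M_def)
    finally have "int n \<le> 2 * (L * M)" using j by linarith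
    moreover obtain i where "M = \<bar>z $ i\<bar>" unfolding M_def by (metis max_def)
    ultimately have "int n \<le> 2 * L * \<bar>z $ i\<bar>" by (simp add: mult.assoc)
    then have "real_of_int (int n) \<le> real_of_int (2 * L * \<bar>z $ i\<bar>)" by (rule of_int_le_iff[THEN iffD2])
    then have "n \<le> 2 * real_of_int L * \<bar>of_int (z $ i)\<bar>" by simp
    then show ?thesis unfolding \<kappa>_def using n z L(2) by (intro freq_lower_coord) auto
  qed
  ultimately show ?thesis by blast
qed

lemma freq_lower_exits:
  fixes \<A> :: "(int^2^2) set"
  assumes "finite \<A>"
  shows "\<exists>\<kappa>>0. \<forall>A\<in>\<A>. \<forall>n z. n > 0 \<longrightarrow> z \<in> box n \<longrightarrow> A *v z \<notin> box n \<longrightarrow> \<kappa> \<le> freq n z"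
  using assms
proof induction
  case empty
  show ?case by (intro exI[of _ 1]) simp
next
  case (insert A \<A>)
  obtain \<kappa> where \<kappa>: "\<kappa> > 0"
    "\<And>B n z. B \<in> \<A> \<Longrightarrow> n > 0 \<Longrightarrow> z \<in> box n \<Longrightarrow> B *v z \<notin> box n \<Longrightarrow> \<kappa> \<le> freq n z"
    using insert.IH by blast
  obtain \<kappa>' where \<kappa>': "\<kappa>' > 0"
    "\<And>n z. n > 0 \<Longrightarrow> z \<in> box n \<Longrightarrow> A *v z \<notin> box n \<Longrightarrow> \<kappa>' \<le> freq n z"
    using freq_lower_exit[of A] by blast
  show ?case
    using \<kappa> \<kappa>' by (intro exI[of _ "min \<kappa> \<kappa>'"]) (auto simp: min_le_iff_disj)
qed

text \<open>A transition of the cut-off \<open>g\<close> of \<open>\<bar>F\<bar>\<close> that enters or leaves the box has its inner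
  endpoint at high frequency.\<close>

lemma cutoff_energy_le:
  fixes F :: "int^2 \<Rightarrow> complex"
  assumes n: "n > 0" and F: "periodic n F" and AB: "A ** B = mat 1" "B ** A = mat 1"
    and \<kappa>: "\<kappa> > 0" "\<And>z. z \<in> box n \<Longrightarrow> A *v z \<notin> box n \<Longrightarrow> \<kappa> \<le> freq n z"
      "\<And>z. z \<in> box n \<Longrightarrow> B *v z \<notin> box n \<Longrightarrow> \<kappa> \<le> freq n z"
    and g: "g = (\<lambda>z. if z \<in> box n then cmod (F z) else 0)" and W: "finite W"
  shows "(\<Sum>z\<in>W. (g z - g (A *v z))\<^sup>2)
       \<le> (\<Sum>z\<in>torus_verts n. (cmod (F z - F (A *v z)))\<^sup>2)
         + 2 / \<kappa> * (\<Sum>z\<in>torus_verts n. freq n z * (cmod (F z))\<^sup>2)"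
proof -
  let ?d = "\<lambda>z. (cmod (F z - F (A *v z)))\<^sup>2" and ?q = "\<lambda>z. freq n z * (cmod (F z))\<^sup>2 / \<kappa>"
  let ?r = "\<lambda>h z. if z \<in> box n then h z else (0::real)"
  have BA: "B *v (A *v z) = z" for z by (simp add: matrix_vector_mul_assoc AB)
  have q0: "?q z \<ge> 0" for z using \<kappa>(1) by (simp add: freq_nonneg)
  have q: "(cmod (F z))\<^sup>2 \<le> ?q z" if "\<kappa> \<le> freq n z" for z
    using mult_right_mono[OF that, of "(cmod (F z))\<^sup>2"] \<kappa>(1) by (simp add: field_simps)
  \<comment> \<open>Inside the box this is the reverse triangle inequality. A leaving arrow is paid
    for at \<open>z\<close>; an entering one at \<open>A *v z\<close>, which \<open>B\<close> sends
    back out of the box.\<close>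
  have pt: "(g z - g (A *v z))\<^sup>2 \<le> ?r ?d z + ?r ?q z + ?r ?q (A *v z)" for z
  proof (cases "z \<in> box n"; cases "A *v z \<in> box n")
    assume *: "z \<in> box n" "A *v z \<in> box n"
    have "(cmod (F z) - cmod (F (A *v z)))\<^sup>2 \<le> ?d z"
      using norm_triangle_ineq3[of "F z" "F (A *v z)"] by (simp add: abs_le_square_iff[symmetric])
    then show ?thesis using * q0[of z] q0[of "A *v z"] by (simp add: g)
  next
    assume *: "z \<in> box n" "A *v z \<notin> box n"
    then have "(cmod (F z))\<^sup>2 \<le> ?q z" by (intro q \<kappa>)
    then show ?thesis using * by (simp add: g add_increasing)
  next
    assume *: "z \<notin> box n" "A *v z \<in> box n"
    then have "(cmod (F (A *v z)))\<^sup>2 \<le> ?q (A *v z)" by (intro q \<kappa>) (simp_all add: BA)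
    then show ?thesis using * by (simp add: g)
  qed (simp add: g)
  have restr: "(\<Sum>z\<in>X. ?r h z) \<le> (\<Sum>z\<in>box n. h z)" if "finite X" "\<And>z. h z \<ge> 0" for X h
  proof -
    have "(\<Sum>z\<in>X. ?r h z) = (\<Sum>z\<in>X \<inter> box n. h z)"
      using that by (simp add: sum.If_cases)
    also have "\<dots> \<le> (\<Sum>z\<in>box n. h z)" using n that by (intro sum_mono2) auto
    finally show ?thesis .
  qed
  \<comment> \<open>Entering arrows have distinct inner endpoints, so together they cost at most one
    sum over the box; leaving arrows cost another, whence \<open>2 / \<kappa>\<close>.\<close>
  have "inj_on ((*v) A) W" using BA by (metis inj_onI)
  then have "(\<Sum>z\<in>W. ?r ?q (A *v z)) = (\<Sum>z\<in>(*v) A ` W. ?r ?q z)"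
    by (simp add: sum.reindex)
  then have 3: "(\<Sum>z\<in>W. ?r ?q (A *v z)) \<le> (\<Sum>z\<in>box n. ?q z)"
    using restr[of "(*v) A ` W" ?q] W q0 by simp
  have "(\<Sum>z\<in>W. (g z - g (A *v z))\<^sup>2) \<le> (\<Sum>z\<in>W. ?r ?d z + ?r ?q z + ?r ?q (A *v z))"
    by (intro sum_mono pt)
  also have "\<dots> \<le> (\<Sum>z\<in>box n. ?d z) + (\<Sum>z\<in>box n. ?q z) + (\<Sum>z\<in>box n. ?q z)"
    unfolding sum.distrib using 3 restr[OF W, of ?d] restr[OF W, of ?q] q0 by (intro add_mono) auto
  also have "(\<Sum>z\<in>box n. ?d z) = (\<Sum>z\<in>torus_verts n. ?d z)"
    using F periodic_comp_mult[OF F, of A] by (intro sum_box n) (simp add: periodic_def)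
  also have "(\<Sum>z\<in>box n. ?q z) = (\<Sum>z\<in>torus_verts n. ?q z)"
    using F periodic_freq[OF n] by (intro sum_box n) (simp add: periodic_def)
  also have "(\<Sum>z\<in>torus_verts n. ?d z) + (\<Sum>z\<in>torus_verts n. ?q z) + (\<Sum>z\<in>torus_verts n. ?q z)
      = (\<Sum>z\<in>torus_verts n. ?d z) + 2 / \<kappa> * (\<Sum>z\<in>torus_verts n. freq n z * (cmod (F z))\<^sup>2)"
    by (simp add: sum_divide_distrib[symmetric])
  finally show ?thesis .
qed

section \<open>The energy of a function on the torus\<close>

definition torus_step :: "int^2^2 \<Rightarrow> nat \<Rightarrow> nat \<Rightarrow> int^2 \<Rightarrow> int^2" where
  "torus_step S n i z = reduce_mod n
     ([z + vector [1, 0], z + vector [0, 1], S *v z, transpose S *v z] ! i)"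

definition lattice_step :: "int^2^2 \<Rightarrow> nat \<Rightarrow> int^2 \<Rightarrow> int^2" where
  "lattice_step S i z = [S *v z, transpose S *v z] ! i"

lemma torus_graph_eq: "torus_graph S n = step_graph (torus_verts n) {0, 1, 2, 3} (torus_step S n)"
  unfolding torus_graph_def step_graph_UN torus_step_def
  by (simp add: numeral_2_eq_2 numeral_3_eq_3 del: transpose_matrix_vector)

lemma lattice_graph_eq: "lattice_graph S = step_graph (UNIV - {0}) {0, 1} (lattice_step S)"
  unfolding lattice_graph_def step_graph_UN lattice_step_def
  by (simp del: transpose_matrix_vector)

text \<open>Counts arrows with multiplicity. For periodic \<open>f\<close> it lies between the edge
  energy and 8 times the edge energy, 8 being twice the number of maps.\<close>

definition torus_energy :: "int^2^2 \<Rightarrow> nat \<Rightarrow> (int^2 \<Rightarrow> complex) \<Rightarrow> real" where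
  "torus_energy S n f = (\<Sum>z\<in>torus_verts n.
     (cmod (f z - f (z + vector [1, 0])))\<^sup>2 + (cmod (f z - f (z + vector [0, 1])))\<^sup>2
     + (cmod (f z - f (S *v z)))\<^sup>2 + (cmod (f z - f (transpose S *v z)))\<^sup>2)"

lemma torus_energy_eq:
  assumes "periodic n f"
  shows "torus_energy S n f
       = (\<Sum>i\<in>{0, 1, 2, 3}. \<Sum>z\<in>torus_verts n. (cmod (f z - f (torus_step S n i z)))\<^sup>2)"
  using periodicD[OF assms]
  by (simp add: torus_energy_def torus_step_def sum.distrib numeral_2_eq_2 numeral_3_eq_3 add_ac
      del: transpose_matrix_vector)

lemma edges_le_torus_energy:
  assumes "periodic n f"
  shows "(\<Sum>e\<in>edges (torus_graph S n). edge_energy f e) \<le> torus_energy S n f"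
  using step_graph_energy_le[of "{0, 1, 2, 3}" "torus_verts n" f "torus_step S n"]
  unfolding torus_graph_eq torus_energy_eq[OF assms] by simp

lemma torus_energy_le_edges:
  assumes "periodic n f"
  shows "torus_energy S n f \<le> 8 * (\<Sum>e\<in>edges (torus_graph S n). edge_energy f e)"
  using step_graph_energy_ge[of "{0, 1, 2, 3}" "torus_verts n" f "torus_step S n"]
  unfolding torus_graph_eq torus_energy_eq[OF assms] by simp

lemma freq_idot:
  "freq n z = (cmod (1 - chr n (idot z (vector [1, 0]))))\<^sup>2 + (cmod (1 - chr n (idot z (vector [0, 1]))))\<^sup>2"
  by (simp add: freq_def idot_def UNIV_2)

lemma invertible_transpose:
  fixes S :: "int^2^2"
  assumes "S ** T = mat 1" "T ** S = mat 1"
  shows "transpose S ** transpose T = mat 1" "transpose T ** transpose S = mat 1"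
  using assms by (simp_all flip: matrix_transpose_mul)

text \<open>The \<open>S\<close>-term of \<open>f\<close> yields the \<open>transpose S\<close>-term
  of its transform and vice versa, so their sum keeps its form.\<close>

lemma torus_energy_dft:
  assumes n: "n > 0" and f: "periodic n f" and ST: "S ** T = mat 1" "T ** S = mat 1"
  shows "n\<^sup>2 * torus_energy S n f =
    (\<Sum>z\<in>torus_verts n. freq n z * (cmod (dft n f z))\<^sup>2
      + (cmod (dft n f z - dft n f (S *v z)))\<^sup>2 + (cmod (dft n f z - dft n f (transpose S *v z)))\<^sup>2)"
proof -
  note tr = invertible_transpose[OF ST]
  show ?thesis
    using dft_mult_energy[OF n f ST] dft_mult_energy[OF n f tr]
      dft_shift_energy[OF n f, of "vector [1, 0]"] dft_shift_energy[OF n f, of "vector [0, 1]"]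
    by (simp add: torus_energy_def freq_idot sum.distrib distrib_left distrib_right transpose_transpose
        del: transpose_matrix_vector)
qed

lemma torus_energy_of_dft:
  assumes n: "n > 0" and g: "periodic n g" and ST: "S ** T = mat 1" "T ** S = mat 1"
  shows "torus_energy S n (dft n g) =
    n\<^sup>2 * (\<Sum>z\<in>torus_verts n. freq n z * (cmod (g z))\<^sup>2
      + (cmod (g z - g (S *v z)))\<^sup>2 + (cmod (g z - g (transpose S *v z)))\<^sup>2)"
proof -
  note tr = invertible_transpose[OF ST]
  show ?thesis
    using dft_mult_energy[OF n g ST] dft_mult_energy[OF n g tr]
      dft_modulate_energy[OF n, of g "vector [1, 0]"] dft_modulate_energy[OF n, of g "vector [0, 1]"]
    by (simp add: torus_energy_def freq_idot sum.distrib distrib_left distrib_right transpose_transpose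
        del: transpose_matrix_vector)
qed

section \<open>Expansion of the torus graphs\<close>

lemma inj_matrix_vector:
  fixes A :: "int^2^2"
  assumes "B ** A = mat 1"
  shows "inj ((*v) A)"
proof (rule inj_on_inverseI)
  show "B *v (A *v z) = z" for z by (simp add: matrix_vector_mul_assoc assms)
qed

lemma inj_lattice_step:
  assumes "S ** T = mat 1" "T ** S = mat 1" "i \<in> {0, 1}"
  shows "inj (lattice_step S i)"
  using inj_matrix_vector[OF assms(2)] inj_matrix_vector[OF invertible_transpose(2)[OF assms(1,2)]]
    assms(3)
  by (auto simp: lattice_step_def[abs_def] simp del: transpose_matrix_vector)

lemma lattice_step_nonzero:
  assumes "S ** T = mat 1" "T ** S = mat 1" "i \<in> {0, 1}" "z \<in> UNIV - {0}"
  shows "lattice_step S i z \<in> UNIV - {0}"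
proof -
  have "lattice_step S i 0 = 0"
    using assms(3) by (auto simp: lattice_step_def simp del: transpose_matrix_vector)
  then show ?thesis using injD[OF inj_lattice_step[OF assms(1-3)], of z 0] assms(4) by auto
qed

lemma torus_step_bij:
  assumes "n > 0" "S ** T = mat 1" "T ** S = mat 1" "i \<in> {0, 1, 2, 3}"
  shows "bij_betw (torus_step S n i) (torus_verts n) (torus_verts n)"
  using bij_torus_add[OF assms(1)] bij_torus_mult[OF assms(1-3)]
    bij_torus_mult[OF assms(1) invertible_transpose[OF assms(2,3)]] assms(4)
  by (auto simp: torus_step_def[abs_def] numeral_2_eq_2 numeral_3_eq_3 simp del: transpose_matrix_vector)

lemma is_ugraph_torus_graph:
  assumes "n > 0" "S ** T = mat 1" "T ** S = mat 1"
  shows "is_ugraph (torus_graph S n)"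
  unfolding torus_graph_eq
  by (intro is_ugraph_step_graph bij_betw_apply[OF torus_step_bij[OF assms]])

text \<open>Makes the infimum in \<open>lambda2\<close> meaningful; \<open>n \<ge> 2\<close> is what
  separates the two point masses.\<close>

lemma test_functions_torus_nonempty:
  assumes "n \<ge> 2"
  shows "test_functions (torus_graph S n) \<noteq> {}"
proof -
  define f :: "int^2 \<Rightarrow> complex" where
    "f = (\<lambda>z. (if z = 0 then 1 else 0) - (if z = vector [1, 0] then 1 else 0))"
  have m: "0 \<in> torus_verts n" "vector [1, 0] \<in> torus_verts n"
    using assms by (auto simp: torus_verts_iff forall_2)
  have "vector [1, 0] \<noteq> (0 :: int^2)" by (simp add: vec_eq_iff forall_2)
  then have "f 0 \<noteq> 0" by (auto simp: f_def)
  then have "f \<in> test_functions (torus_graph S n)"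
    using m by (auto simp: test_functions_def torus_graph_def f_def sum_subtractf)
  then show ?thesis by blast
qed

text \<open>The spectral gap in terms of arrows, with \<open>c\<close> chosen before
  \<open>n\<close>: Cheeger's inequality is applied to the cut-off transform of
  \<open>f\<close>.\<close>

lemma torus_energy_bound:
  fixes S :: "int^2^2"
  assumes ST: "S ** T = mat 1" "T ** S = mat 1" and "\<epsilon> > 0"
    and exp: "\<And>U. finite U \<Longrightarrow> U \<subseteq> verts (lattice_graph S) \<Longrightarrow>
        \<epsilon> * real (card U) \<le> real (card (edge_boundary (lattice_graph S) U))"
  shows "\<exists>c>0. \<forall>n f. n > 0 \<longrightarrow> periodic n f \<longrightarrow> (\<Sum>z\<in>torus_verts n. f z) = 0 \<longrightarrow>
      c * (\<Sum>z\<in>torus_verts n. (cmod (f z))\<^sup>2) \<le> torus_energy S n f"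
proof -
  note tr = invertible_transpose[OF ST]
  \<comment> \<open>The inverses are included because an arrow entering the box leaves it when
    reversed.\<close>
  obtain \<kappa> where "\<kappa> > 0"
    and exits: "\<And>A n z. A \<in> {S, T, transpose S, transpose T} \<Longrightarrow> n > 0 \<Longrightarrow> z \<in> box n \<Longrightarrow>
      A *v z \<notin> box n \<Longrightarrow> \<kappa> \<le> freq n z"
    using freq_lower_exits[of "{S, T, transpose S, transpose T}"] by blast
  \<comment> \<open>Each of the two cut-offs costs \<open>2 / \<kappa>\<close> times the translation
    energy, while the matrix terms enter with coefficient 1; \<open>C\<close> dominates both
    \<open>4 / \<kappa>\<close> and 1.\<close>
  define C where "C = 1 + 4 / \<kappa>"
  have C: "C > 0" "1 \<le> C" "4 / \<kappa> \<le> C" using \<open>\<kappa> > 0\<close> by (auto simp: C_def add_pos_pos)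
  have "\<epsilon>\<^sup>2 * (\<Sum>z\<in>torus_verts n. (cmod (f z))\<^sup>2) \<le> 8 * C * torus_energy S n f"
    if n: "n > 0" and f: "periodic n f" and f0: "(\<Sum>z\<in>torus_verts n. f z) = 0" for n f
  proof -
    let ?V = "torus_verts n"
    define F where "F = dft n f"
    have F: "periodic n F" unfolding F_def by (rule periodic_dft[OF n])
    \<comment> \<open>Mean zero removes frequency 0, so the cut-off is supported on vertices of the
      lattice graph.\<close>
    have F0: "F 0 = 0" using f0 by (simp add: F_def dft_def)
    define g where "g = (\<lambda>z. if z \<in> box n then cmod (F z) else 0)"
    let ?Q = "\<Sum>z\<in>?V. freq n z * (cmod (F z))\<^sup>2"
    let ?E1 = "\<Sum>z\<in>?V. (cmod (F z - F (S *v z)))\<^sup>2"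
    let ?E2 = "\<Sum>z\<in>?V. (cmod (F z - F (transpose S *v z)))\<^sup>2"
    have g0: "g z \<ge> 0" for z by (simp add: g_def)
    have supp: "g z = 0" if "z \<notin> box n - {0}" for z using that F0 by (auto simp: g_def)
    have "\<exists>W. finite W \<and> \<epsilon>\<^sup>2 * (\<Sum>x\<in>box n - {0}. (g x)\<^sup>2)
        \<le> 4 * card {0, 1::nat} * (\<Sum>i\<in>{0, 1}. \<Sum>z\<in>W. (g z - g (lattice_step S i z))\<^sup>2)"
    proof (rule step_graph_cheeger[where V = "UNIV - {0}"])
      show "inj (lattice_step S i)" if "i \<in> {0, 1}" for i by (rule inj_lattice_step[OF ST that])
      show "\<epsilon> * card U \<le> card (edge_boundary (step_graph (UNIV - {0}) {0, 1} (lattice_step S)) U)"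
        if "finite U" "U \<subseteq> UNIV - {0}" for U
        using exp[OF that(1)] that(2) by (simp add: lattice_graph_eq step_graph_def)
    qed (use n \<open>\<epsilon> > 0\<close> g0 supp in auto)
    then obtain W where W: "finite W"
      and ch: "\<epsilon>\<^sup>2 * (\<Sum>x\<in>box n - {0}. (g x)\<^sup>2)
        \<le> 8 * ((\<Sum>z\<in>W. (g z - g (S *v z))\<^sup>2) + (\<Sum>z\<in>W. (g z - g (transpose S *v z))\<^sup>2))"
      by (auto simp: lattice_step_def simp del: transpose_matrix_vector)
    have b1: "(\<Sum>z\<in>W. (g z - g (S *v z))\<^sup>2) \<le> ?E1 + 2 / \<kappa> * ?Q"
      by (rule cutoff_energy_le[OF n F ST \<open>\<kappa> > 0\<close> _ _ g_def W]) (rule exits[OF _ n]; simp)+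
    have b2: "(\<Sum>z\<in>W. (g z - g (transpose S *v z))\<^sup>2) \<le> ?E2 + 2 / \<kappa> * ?Q"
      by (rule cutoff_energy_le[OF n F tr \<open>\<kappa> > 0\<close> _ _ g_def W])
        (rule exits[OF _ n]; simp del: transpose_matrix_vector)+
    have norm_g: "(\<Sum>x\<in>box n - {0}. (g x)\<^sup>2) = n\<^sup>2 * (\<Sum>z\<in>?V. (cmod (f z))\<^sup>2)"
    proof -
      have "(\<Sum>x\<in>box n - {0}. (g x)\<^sup>2) = (\<Sum>x\<in>box n. (cmod (F x))\<^sup>2)"
        using n F0 by (intro sum.mono_neutral_cong_left) (auto simp: g_def)
      also have "\<dots> = (\<Sum>z\<in>?V. (cmod (F z))\<^sup>2)"
        using F by (intro sum_box n) (simp add: periodic_def)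
      finally show ?thesis using parseval[OF n, of f] by (simp add: F_def)
    qed
    have E: "n\<^sup>2 * torus_energy S n f = ?Q + ?E1 + ?E2"
      using torus_energy_dft[OF n f ST] unfolding F_def
      by (simp add: sum.distrib del: transpose_matrix_vector)
    have nonneg: "?Q \<ge> 0" "?E1 \<ge> 0" "?E2 \<ge> 0"
      by (auto intro!: sum_nonneg mult_nonneg_nonneg freq_nonneg)
    have "n\<^sup>2 * (\<epsilon>\<^sup>2 * (\<Sum>z\<in>?V. (cmod (f z))\<^sup>2)) \<le> 8 * (?E1 + ?E2 + 4 / \<kappa> * ?Q)"
      using ch b1 b2 norm_g by (simp add: mult.left_commute)
    also have "\<dots> \<le> 8 * (C * (?Q + ?E1 + ?E2))"
      using mult_right_mono[OF C(2) nonneg(2)] mult_right_mono[OF C(2) nonneg(3)]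
        mult_right_mono[OF C(3) nonneg(1)] by (simp add: distrib_left)
    also have "\<dots> = n\<^sup>2 * (8 * C * torus_energy S n f)"
      unfolding E[symmetric] by simp
    finally show ?thesis using n by simp
  qed
  then have "\<epsilon>\<^sup>2 / (8 * C) * (\<Sum>z\<in>torus_verts n. (cmod (f z))\<^sup>2) \<le> torus_energy S n f"
    if "n > 0" "periodic n f" "(\<Sum>z\<in>torus_verts n. f z) = 0" for n f
    using that C by (simp add: field_simps)
  then show ?thesis using C \<open>\<epsilon> > 0\<close> by (intro exI[of _ "\<epsilon>\<^sup>2 / (8 * C)"]) auto
qed

lemma expander_family_torus:
  fixes S :: "int^2^2"
  assumes ST: "S ** T = mat 1" "T ** S = mat 1"
    and exp: "positive_Cheeger_constant (lattice_graph S)"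
  shows "expander_family {2..} (torus_graph S)"
proof -
  obtain \<epsilon> :: real where "\<epsilon> > 0" and \<epsilon>: "\<And>U. finite U \<Longrightarrow> U \<subseteq> verts (lattice_graph S) \<Longrightarrow>
        \<epsilon> * real (card U) \<le> real (card (edge_boundary (lattice_graph S) U))"
    using exp by (auto simp: positive_Cheeger_constant_def)
  from torus_energy_bound[OF ST this]
  obtain c where "c > 0" and c: "\<And>n f. n > 0 \<Longrightarrow> periodic n f \<Longrightarrow> (\<Sum>z\<in>torus_verts n. f z) = 0 \<Longrightarrow>
      c * (\<Sum>z\<in>torus_verts n. (cmod (f z))\<^sup>2) \<le> torus_energy S n f"
    by metis
  have "c / 8 \<le> lambda2 (torus_graph S n)" if n: "n \<ge> 2" for n
    unfolding lambda2_def
  proof (rule cINF_greatest[OF test_functions_torus_nonempty[OF n]])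
    fix f assume f: "f \<in> test_functions (torus_graph S n)"
    let ?V = "torus_verts n" and ?E = "edges (torus_graph S n)"
    \<comment> \<open>Values of \<open>f\<close> off the torus are arbitrary; the periodic extension
      agrees with \<open>f\<close> on every edge.\<close>
    define f' where "f' = (\<lambda>z. f (reduce_mod n z))"
    have V: "verts (torus_graph S n) = ?V" by (simp add: torus_graph_def)
    have eq: "f' z = f z" if "z \<in> ?V" for z using that by (simp add: f'_def reduce_mod_id)
    have per: "periodic n f'" by (simp add: f'_def periodic_def)
    have "(\<Sum>z\<in>?V. f' z) = 0" using f eq by (simp add: test_functions_def V)
    then have "c * (\<Sum>z\<in>?V. (cmod (f z))\<^sup>2) \<le> torus_energy S n f'"
      using c[OF _ per] n eq by simp
    also have "\<dots> \<le> 8 * (\<Sum>e\<in>?E. edge_energy f' e)"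
      by (rule torus_energy_le_edges[OF per])
    also have "(\<Sum>e\<in>?E. edge_energy f' e) = (\<Sum>e\<in>?E. edge_energy f e)"
    proof (rule sum.cong[OF refl])
      fix e assume "e \<in> ?E"
      then obtain u v where "u \<in> ?V" "v \<in> ?V" "e = {u, v}"
        using is_ugraph_torus_graph[OF _ ST, of n] n unfolding is_ugraph_def V by auto
      then show "edge_energy f' e = edge_energy f e" by (simp add: eq)
    qed
    finally have "c / 8 * (\<Sum>z\<in>?V. (cmod (f z))\<^sup>2) \<le> (\<Sum>e\<in>?E. edge_energy f e)" by simp
    moreover obtain u where "u \<in> ?V" "f u \<noteq> 0" using f by (auto simp: test_functions_def V)
    then have "(\<Sum>z\<in>?V. (cmod (f z))\<^sup>2) > 0" by (intro sum_pos2[of _ u]) auto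
    ultimately show "c / 8 \<le> rayleigh_quotient (torus_graph S n) f"
      by (simp add: rayleigh_quotient_def V le_divide_eq)
  qed
  moreover have "degrees_bounded_by 8 (torus_graph S n)" if n: "n \<ge> 2" for n
    using degrees_bounded_by_step_graph[of "{0, 1, 2, 3}" "torus_step S n" "torus_verts n"]
      torus_step_bij[OF _ ST] n
    unfolding torus_graph_eq by (auto simp: bij_betw_def)
  moreover have "is_ugraph (torus_graph S n)" if "n \<ge> 2" for n
    using that by (intro is_ugraph_torus_graph[OF _ ST]) simp
  moreover have "finite (verts (torus_graph S n))" for n by (simp add: torus_graph_def)
  ultimately show ?thesis
    unfolding expander_family_def using \<open>c > 0\<close> by (auto simp: infinite_Ici intro!: exI[of _ "c / 8"])
qed

section \<open>Expansion of the lattice graph\<close>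

text \<open>A single \<open>n\<close>, large in terms of \<open>U\<close>, suffices. The translation
  energy costs at most \<open>c / 2 * card U\<close>, which is absorbed on the left; the two matrix
  terms cost \<open>2 * card ?B\<close> each, and \<open>c / 8\<close> results.\<close>

lemma lattice_expansion:
  fixes S :: "int^2^2" and U :: "(int^2) set"
  assumes ST: "S ** T = mat 1" "T ** S = mat 1"
    and "c > 0" and gap: "\<And>n. n \<ge> 2 \<Longrightarrow> c \<le> lambda2 (torus_graph S n)"
    and U: "finite U" "U \<subseteq> UNIV - {0}" "U \<noteq> {}"
  shows "c / 8 * real (card U) \<le> real (card (edge_boundary (lattice_graph S) U))"
proof -
  \<comment> \<open>For \<open>n\<close> above this bound \<open>U\<close> lies in the box, so it
    embeds in the torus and misses the class of 0.\<close>
  define R where "R = (\<Sum>u\<in>U. \<Sum>i\<in>UNIV. 2 * \<bar>u $ i\<bar>)"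
  have R: "2 * \<bar>u $ i\<bar> \<le> R" if "u \<in> U" for u i
  proof -
    have "2 * \<bar>u $ i\<bar> \<le> (\<Sum>i\<in>UNIV. 2 * \<bar>u $ i\<bar>)" by (rule member_le_sum) auto
    also have "\<dots> \<le> R" unfolding R_def using that U by (intro member_le_sum) (auto intro: sum_nonneg)
    finally show ?thesis .
  qed
  \<comment> \<open>By \<open>freq_upper\<close>, \<open>M / n^2\<close> bounds the total frequency
    weight of \<open>U\<close>.\<close>
  define M :: real where "M = (2 * pi)\<^sup>2 * (\<Sum>u\<in>U. \<Sum>i\<in>UNIV. (of_int (u $ i))\<^sup>2)"
  have "(\<lambda>n. M / (real n)\<^sup>2) \<longlonglongrightarrow> 0"
    by (intro tendsto_divide_0[OF tendsto_const] filterlim_at_top_imp_at_infinity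
        filterlim_pow_at_top filterlim_real_sequentially) auto
  moreover have "c / 2 * card U > 0" using \<open>c > 0\<close> U by (simp add: card_gt_0_iff)
  ultimately have "eventually (\<lambda>n. M / (real n)\<^sup>2 < c / 2 * card U) sequentially"
    by (rule order_tendstoD)
  moreover have "eventually (\<lambda>n. n > nat R \<and> n \<ge> 2) sequentially"
    by (intro eventually_conj eventually_gt_at_top eventually_ge_at_top)
  ultimately have "eventually (\<lambda>n. M / (real n)\<^sup>2 < c / 2 * card U \<and> n > nat R \<and> n \<ge> 2) sequentially"
    by (rule eventually_conj)
  then obtain n where nM: "M / (real n)\<^sup>2 < c / 2 * card U" and nR: "n > nat R" and n2: "n \<ge> 2"
    by (auto simp: eventually_sequentially)
  have n: "n > 0" using n2 by simp
  let ?V = "torus_verts n"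
  let ?B = "edge_boundary (lattice_graph S) U"
  have box: "u \<in> box n" if "u \<in> U" for u
    unfolding box_def
  proof (intro CollectI allI)
    fix i
    show "- int n < 2 * u $ i \<and> 2 * u $ i \<le> int n" using R[OF that, of i] nR by linarith
  qed
  have inj: "inj_on (reduce_mod n) U"
    using bij_box_torus[OF n] box by (auto simp: bij_betw_def intro: inj_on_subset)
  define g :: "int^2 \<Rightarrow> complex" where "g = (\<lambda>z. if reduce_mod n z \<in> reduce_mod n ` U then 1 else 0)"
  have g: "periodic n g" by (simp add: g_def periodic_def)
  have sum_g: "(\<Sum>z\<in>?V. h z * (cmod (g z))\<^sup>2) = (\<Sum>u\<in>U. h u)" if h: "periodic n h" for h :: "int^2 \<Rightarrow> real"
  proof -
    have "(\<Sum>z\<in>?V. h z * (cmod (g z))\<^sup>2) = (\<Sum>z\<in>?V. if z \<in> reduce_mod n ` U then h z else 0)"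
      by (intro sum.cong) (auto simp: g_def reduce_mod_id)
    also have "\<dots> = (\<Sum>z\<in>reduce_mod n ` U. h z)"
      by (subst sum.inter_restrict[symmetric]) (auto intro!: sum.cong reduce_mod_in[OF n])
    also have "\<dots> = (\<Sum>u\<in>U. h u)" using inj by (simp add: sum.reindex periodicD[OF h])
    finally show ?thesis .
  qed
  define f where "f = dft n g"
  have f: "periodic n f" unfolding f_def by (rule periodic_dft[OF n])
  have norm_f: "(\<Sum>z\<in>?V. (cmod (f z))\<^sup>2) = n\<^sup>2 * card U"
    using parseval[OF n, of g] sum_g[of "\<lambda>_. 1"] by (simp add: f_def periodic_def)
  have g0: "g 0 = 0"
  proof -
    have "reduce_mod n 0 \<notin> reduce_mod n ` U"
    proof
      assume "reduce_mod n 0 \<in> reduce_mod n ` U"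
      then obtain u where u: "u \<in> U" "reduce_mod n 0 = reduce_mod n u" by auto
      have "0 \<in> box n" using n by (simp add: box_def)
      then have "u = 0"
        using u box bij_box_torus[OF n] by (auto simp: bij_betw_def dest: inj_onD)
      then show False using u U by auto
    qed
    then show ?thesis by (simp add: g_def)
  qed
  \<comment> \<open>The sum of a transform is \<open>n^2\<close> times the value of the function at
    0, and \<open>g\<close> vanishes there.\<close>
  have sum_f: "(\<Sum>z\<in>?V. f z) = 0"
  proof -
    have "(\<Sum>z\<in>?V. f z) = (\<Sum>w\<in>?V. \<Sum>z\<in>?V. g w * chr n (idot z w))"
      unfolding f_def dft_def by (rule sum.swap)
    also have "\<dots> = (\<Sum>w\<in>?V. g w * (\<Sum>z\<in>?V. chr n (idot z w)))"
      by (simp add: sum_distrib_left)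
    also have "\<dots> = 0"
    proof (rule sum.neutral, rule ballI)
      fix w assume "w \<in> ?V"
      then show "g w * (\<Sum>z\<in>?V. chr n (idot z w)) = 0"
        using g0 by (simp add: sum_chr[OF n] reduce_mod_id)
    qed
    finally show ?thesis .
  qed
  \<comment> \<open>Each jump of \<open>g\<close> lifts to a jump of \<open>U\<close> in the
    lattice. If \<open>z\<close> is in the class of some \<open>u \<in> U\<close>, the lift is
    \<open>u\<close>; otherwise \<open>A *v z\<close> is in the class of some
    \<open>w \<in> U\<close>, and the lift is \<open>A' *v w\<close>, which need not lie in the
    box.\<close>
  have cut: "(\<Sum>z\<in>?V. (cmod (g z - g (A *v z)))\<^sup>2) \<le> 2 * card ?B"
    if A: "A ** A' = mat 1" "A' ** A = mat 1" and i: "i \<in> {0, 1}" "lattice_step S i = (*v) A" for A A' i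
  proof -
    let ?X = "{z \<in> UNIV - {0}. (z \<in> U) \<noteq> (A *v z \<in> U)}"
    have AA: "A' *v (A *v z) = z" "A *v (A' *v z) = z" for z by (simp_all add: matrix_vector_mul_assoc A)
    have X: "card ?X \<le> 2 * card ?B" "finite ?X"
      using card_edge_boundary_step_graph[of "{0, 1}" i "lattice_step S" "UNIV - {0}" U]
        inj_on_subset[OF inj_lattice_step[OF ST]] lattice_step_nonzero[OF ST i(1)] i U
      unfolding lattice_graph_eq by auto
    have "{z \<in> ?V. g z \<noteq> g (A *v z)} \<subseteq> reduce_mod n ` ?X"
    proof
      fix z assume "z \<in> {z \<in> ?V. g z \<noteq> g (A *v z)}"
      then have z: "reduce_mod n z = z" and "g z \<noteq> g (A *v z)" by (auto simp: reduce_mod_id)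
      then consider u where "u \<in> U" "z = reduce_mod n u" "reduce_mod n (A *v z) \<notin> reduce_mod n ` U"
        | w where "z \<notin> reduce_mod n ` U" "w \<in> U" "reduce_mod n (A *v z) = reduce_mod n w"
        by (auto simp: g_def split: if_splits)
      then show "z \<in> reduce_mod n ` ?X"
      proof cases
        case 1
        then have "A *v u \<notin> U" by (auto simp: reduce_mod_mult)
        then show ?thesis using 1 U by auto
      next
        case 2
        have "reduce_mod n (A' *v w) = reduce_mod n (A' *v reduce_mod n (A *v z))"
          unfolding 2(3) by (simp add: reduce_mod_mult)
        also have "\<dots> = z" by (simp add: reduce_mod_mult AA z)
        finally have w: "reduce_mod n (A' *v w) = z" .
        have "A' *v w \<notin> U" using w 2(1) by auto
        moreover have "A' *v w \<noteq> 0" using AA(2)[of w] 2(2) U by auto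
        ultimately have "A' *v w \<in> ?X" using 2(2) by (simp add: AA)
        then show ?thesis using w by blast
      qed
    qed
    then have "card {z \<in> ?V. g z \<noteq> g (A *v z)} \<le> card (reduce_mod n ` ?X)"
      using X by (intro card_mono) auto
    also have "\<dots> \<le> card ?X" by (rule card_image_le[OF X(2)])
    finally have "card {z \<in> ?V. g z \<noteq> g (A *v z)} \<le> 2 * card ?B" using X(1) by linarith
    moreover have "(\<Sum>z\<in>?V. (cmod (g z - g (A *v z)))\<^sup>2) = (\<Sum>z\<in>?V. if g z \<noteq> g (A *v z) then 1 else 0)"
      by (intro sum.cong) (auto simp: g_def)
    ultimately show ?thesis by (simp add: sum.If_cases Int_def)
  qed
  have freq_g: "(\<Sum>z\<in>?V. freq n z * (cmod (g z))\<^sup>2) \<le> M / (real n)\<^sup>2"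
  proof -
    have "(\<Sum>z\<in>?V. freq n z * (cmod (g z))\<^sup>2) = (\<Sum>u\<in>U. freq n u)"
      by (rule sum_g[OF periodic_freq[OF n]])
    also have "\<dots> \<le> (\<Sum>u\<in>U. (2 * pi / n)\<^sup>2 * (\<Sum>i\<in>UNIV. (of_int (u $ i))\<^sup>2))"
      by (intro sum_mono freq_upper)
    also have "\<dots> = M / (real n)\<^sup>2"
      unfolding M_def sum_distrib_left[symmetric] by (simp add: power_divide)
    finally show ?thesis .
  qed
  have "torus_energy S n f = n\<^sup>2 * ((\<Sum>z\<in>?V. freq n z * (cmod (g z))\<^sup>2)
      + (\<Sum>z\<in>?V. (cmod (g z - g (S *v z)))\<^sup>2) + (\<Sum>z\<in>?V. (cmod (g z - g (transpose S *v z)))\<^sup>2))"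
    unfolding f_def torus_energy_of_dft[OF n g ST] by (simp add: sum.distrib)
  also have "\<dots> \<le> n\<^sup>2 * (c / 2 * card U + 2 * card ?B + 2 * card ?B)"
    using order.trans[OF freq_g less_imp_le[OF nM]] cut[OF ST, of 0] cut[OF invertible_transpose[OF ST], of 1]
    by (intro mult_left_mono add_mono) (auto simp: lattice_step_def fun_eq_iff simp del: transpose_matrix_vector)
  finally have energy: "torus_energy S n f \<le> n\<^sup>2 * (c / 2 * card U + 4 * card ?B)" by (simp add: add.commute)
  have V: "verts (torus_graph S n) = ?V" by (simp add: torus_graph_def)
  have pos: "(\<Sum>z\<in>?V. (cmod (f z))\<^sup>2) > 0"
    using n U by (simp add: norm_f card_gt_0_iff)
  have "f \<in> test_functions (torus_graph S n)"
  proof -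
    have "\<exists>z\<in>?V. f z \<noteq> 0" using pos by (rule contrapos_pp) simp
    then show ?thesis using sum_f by (simp add: test_functions_def V)
  qed
  moreover have "bdd_below (rayleigh_quotient (torus_graph S n) ` test_functions (torus_graph S n))"
  proof (rule bdd_belowI2)
    show "0 \<le> rayleigh_quotient (torus_graph S n) h" for h
      unfolding rayleigh_quotient_def
      by (intro divide_nonneg_nonneg sum_nonneg) (auto simp: torus_graph_def)
  qed
  ultimately have "lambda2 (torus_graph S n) \<le> rayleigh_quotient (torus_graph S n) f"
    unfolding lambda2_def by (rule cINF_lower[rotated])
  then have "c \<le> (\<Sum>e\<in>edges (torus_graph S n). edge_energy f e) / (\<Sum>z\<in>?V. (cmod (f z))\<^sup>2)"
    using gap[OF n2] by (simp add: rayleigh_quotient_def V)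
  then have "c * (\<Sum>z\<in>?V. (cmod (f z))\<^sup>2) \<le> (\<Sum>e\<in>edges (torus_graph S n). edge_energy f e)"
    using pos by (simp add: le_divide_eq)
  also have "\<dots> \<le> torus_energy S n f" by (rule edges_le_torus_energy[OF f])
  also note energy
  finally have "n\<^sup>2 * (c * card U) \<le> n\<^sup>2 * (c / 2 * card U + 4 * card ?B)"
    by (simp add: norm_f mult_ac)
  then have "c * card U \<le> c / 2 * card U + 4 * card ?B"
    using n by (simp only: mult_le_cancel_left_pos zero_less_power of_nat_0_less_iff of_nat_power)
  then show ?thesis by simp
qed

lemma positive_Cheeger_lattice:
  fixes S :: "int^2^2"
  assumes ST: "S ** T = mat 1" "T ** S = mat 1"
    and exp: "expander_family {2..} (torus_graph S)"
  shows "positive_Cheeger_constant (lattice_graph S)"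
  unfolding positive_Cheeger_constant_def
proof (intro conjI)
  show "is_ugraph (lattice_graph S)"
    unfolding lattice_graph_eq using lattice_step_nonzero[OF ST] by (rule is_ugraph_step_graph)
  have "inj (\<lambda>k::int. (vector [k, 0] :: int^2))"
    by (rule injI) (simp add: vec_eq_iff forall_2)
  then have "infinite (UNIV :: (int^2) set)"
    using finite_subset[OF subset_UNIV] infinite_UNIV_int by (metis finite_imageD)
  then show "infinite (verts (lattice_graph S))"
    by (simp add: lattice_graph_def)
  show "\<exists>d. degrees_bounded_by d (lattice_graph S)"
    unfolding lattice_graph_eq
    by (intro exI, rule degrees_bounded_by_step_graph)
      (simp, rule inj_on_subset[OF inj_lattice_step[OF ST] subset_UNIV])
  obtain c where "c > 0" and c: "\<And>n. n \<ge> 2 \<Longrightarrow> c \<le> lambda2 (torus_graph S n)"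
    using exp by (auto simp: expander_family_def)
  have "c / 8 * real (card U) \<le> real (card (edge_boundary (lattice_graph S) U))"
    if "finite U" "U \<subseteq> verts (lattice_graph S)" for U
    using lattice_expansion[OF ST \<open>c > 0\<close> c that(1)] that(2)
    by (cases "U = {}") (auto simp: lattice_graph_def)
  then show "\<exists>\<epsilon>>0. \<forall>U. finite U \<and> U \<subseteq> verts (lattice_graph S) \<longrightarrow>
      \<epsilon> * real (card U) \<le> real (card (edge_boundary (lattice_graph S) U))"
    using \<open>c > 0\<close> by (intro exI[of _ "c / 8"]) auto
qed

theorem mainTheorem4:
  fixes S :: "int^2^2"
  assumes "invertible S"
  shows "expander_family {2..} (torus_graph S) \<longleftrightarrow> positive_Cheeger_constant (lattice_graph S)"
proof -
  obtain T where "S ** T = mat 1" "T ** S = mat 1"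
    using assms by (auto simp: invertible_def)
  then show ?thesis
    using expander_family_torus positive_Cheeger_lattice by blast
qed

end
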